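(* Let $X$ be a non-zero (i.e. not identically zero) vector field on a compact surface $S$. Then there is a smooth function $f:S\to[0,1]$ such that: (1) The vector field $fX$ is not non-wandering (i.e. the flow generated by $fX$ is not a non-wandering flow). (2) Every orbit of $X$ is a union of orbits of $fX$. (3) The set $f^{-1}(0)$ is totally disconnected. (4) If the singular point set $\operatorname{Sing}(X)$ is totally disconnected, then so is $\operatorname{Sing}(fX)$.
   Context: A surface is a paracompact two-dimensional manifold (possibly with boundary). Vector fields are identified with the flows (continuous $\mathbb{R}$-actions) they generate; $X$ is understood to be a vector field generating a flow on $S$. $\operatorname{Sing}(X)$ denotes the set of singular points (points fixed by the flow for all times, i.e. zeros of the vector field). For a flow $v$ with time-$t$ maps $v_t$, a point is wandering if it has a neighborhood $U$ and there is $N>0$ such that $v_t(U)\cap U=\emptyset$ for all $t>N$; it is non-wandering if it is not wandering; a flow is non-wandering if all points are non-wandering. *)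

theory Defs
  imports "HOL-Analysis.Analysis"
begin

subsection \<open>Smooth maps\<close>

primrec Ck_on :: "nat \<Rightarrow> 'a::euclidean_space set \<Rightarrow> ('a \<Rightarrow> 'b::real_normed_vector) \<Rightarrow> bool" where
  "Ck_on 0 U f \<longleftrightarrow> continuous_on U f"
| "Ck_on (Suc k) U f \<longleftrightarrow>
     (\<forall>x\<in>U. f differentiable (at x)) \<and> (\<forall>h. Ck_on k U (\<lambda>x. frechet_derivative f (at x) h))"

text \<open>Since \<open>A\<close> need not be open (e.g. a relatively open subset of a half plane), smoothness
  on \<open>A\<close> means that \<open>f\<close> extends smoothly to a neighbourhood of each point of \<open>A\<close>.\<close>

definition smooth_on :: "'a::euclidean_space set \<Rightarrow> ('a \<Rightarrow> 'b::real_normed_vector) \<Rightarrow> bool" where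
  "smooth_on A f \<longleftrightarrow>
     (\<forall>x\<in>A. \<exists>U g. open U \<and> x \<in> U \<and> (\<forall>k. Ck_on k U g) \<and> (\<forall>y\<in>U \<inter> A. g y = f y))"

subsection \<open>Compact smooth surfaces, possibly with boundary\<close>

definition half_plane :: "(real \<times> real) set" where
  "half_plane = {p. 0 \<le> snd p}"

type_synonym 'a chart = "'a set \<times> ('a \<Rightarrow> real \<times> real)"

text \<open>Interior charts are covered as well: an open subset of the plane is locally a translate of an
  open subset of the half plane that does not meet the boundary line.\<close>

definition surface_chart :: "'a::t2_space set \<Rightarrow> 'a chart \<Rightarrow> bool" where
  "surface_chart S c \<longleftrightarrow> (case c of (U, \<phi>) \<Rightarrow>
     openin (top_of_set S) U \<and> openin (top_of_set half_plane) (\<phi> ` U) \<and>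
     homeomorphism U (\<phi> ` U) \<phi> (inv_into U \<phi>))"

definition smooth_atlas :: "'a::t2_space set \<Rightarrow> 'a chart set \<Rightarrow> bool" where
  "smooth_atlas S \<A> \<longleftrightarrow>
     (\<forall>c\<in>\<A>. surface_chart S c) \<and> (\<Union>c\<in>\<A>. fst c) = S \<and>
     (\<forall>(U, \<phi>)\<in>\<A>. \<forall>(V, \<psi>)\<in>\<A>. smooth_on (\<phi> ` (U \<inter> V)) (\<psi> \<circ> inv_into U \<phi>))"

text \<open>The Hausdorff property comes from the type class; paracompactness and second countability
  follow from compactness.\<close>

definition compact_surface :: "'a::t2_space set \<Rightarrow> 'a chart set \<Rightarrow> bool" where
  "compact_surface S \<A> \<longleftrightarrow> compact S \<and> smooth_atlas S \<A>"

definition smooth_fun :: "'a chart set \<Rightarrow> ('a \<Rightarrow> real) \<Rightarrow> bool" where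
  "smooth_fun \<A> g \<longleftrightarrow> (\<forall>(U, \<phi>)\<in>\<A>. smooth_on (\<phi> ` U) (g \<circ> inv_into U \<phi>))"

subsection \<open>Vector fields\<close>

text \<open>Tangent vectors at \<open>p\<close> are derivations at \<open>p\<close> of the algebra of smooth functions on \<open>S\<close>.
  Smooth functions are HOL functions on the whole type, hence the condition that
  values outside \<open>S\<close> are irrelevant.\<close>

definition tangent_vector ::
  "'a::t2_space set \<Rightarrow> 'a chart set \<Rightarrow> 'a \<Rightarrow> (('a \<Rightarrow> real) \<Rightarrow> real) \<Rightarrow> bool" where
  "tangent_vector S \<A> p D \<longleftrightarrow>
     (\<forall>g h. smooth_fun \<A> g \<and> smooth_fun \<A> h \<longrightarrow>
        D (\<lambda>x. g x + h x) = D g + D h \<and>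
        (\<forall>a. D (\<lambda>x. a * g x) = a * D g) \<and>
        D (\<lambda>x. g x * h x) = g p * D h + h p * D g \<and>
        ((\<forall>x\<in>S. g x = h x) \<longrightarrow> D g = D h))"

type_synonym 'a vfield = "'a \<Rightarrow> ('a \<Rightarrow> real) \<Rightarrow> real"

text \<open>Only continuity is required of a vector field; this includes the \<open>C\<^sup>r\<close> and smooth ones.\<close>

definition vector_field :: "'a::t2_space set \<Rightarrow> 'a chart set \<Rightarrow> 'a vfield \<Rightarrow> bool" where
  "vector_field S \<A> X \<longleftrightarrow>
     (\<forall>p\<in>S. tangent_vector S \<A> p (X p)) \<and>
     (\<forall>g. smooth_fun \<A> g \<longrightarrow> continuous_on S (\<lambda>p. X p g))"

definition zero_of :: "'a chart set \<Rightarrow> 'a vfield \<Rightarrow> 'a \<Rightarrow> bool" where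
  "zero_of \<A> X p \<longleftrightarrow> (\<forall>g. smooth_fun \<A> g \<longrightarrow> X p g = 0)"

definition scale_field :: "('a \<Rightarrow> real) \<Rightarrow> 'a vfield \<Rightarrow> 'a vfield" where
  "scale_field f X = (\<lambda>p g. f p * X p g)"

subsection \<open>Flows\<close>

definition is_flow :: "'a::t2_space set \<Rightarrow> (real \<Rightarrow> 'a \<Rightarrow> 'a) \<Rightarrow> bool" where
  "is_flow S v \<longleftrightarrow>
     continuous_on (UNIV \<times> S) (\<lambda>(t, x). v t x) \<and>
     (\<forall>x\<in>S. (\<forall>t. v t x \<in> S) \<and> v 0 x = x \<and> (\<forall>s t. v (s + t) x = v s (v t x)))"

definition integral_curve ::
  "'a::t2_space set \<Rightarrow> 'a chart set \<Rightarrow> 'a vfield \<Rightarrow> real set \<Rightarrow> (real \<Rightarrow> 'a) \<Rightarrow> bool" where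
  "integral_curve S \<A> X I \<gamma> \<longleftrightarrow>
     continuous_on I \<gamma> \<and> \<gamma> ` I \<subseteq> S \<and>
     (\<forall>g t. smooth_fun \<A> g \<and> t \<in> I \<longrightarrow>
        ((\<lambda>s. g (\<gamma> s)) has_real_derivative X (\<gamma> t) g) (at t))"

text \<open>The trajectories of the flow are integral curves of the field, and they are the only ones.
  Uniqueness is automatic for locally Lipschitz fields. For merely continuous fields it makes the
  flow generated by the field unique on \<open>S\<close>, with the zeros of the field as its fixed points.\<close>

definition generates ::
  "'a::t2_space set \<Rightarrow> 'a chart set \<Rightarrow> 'a vfield \<Rightarrow> (real \<Rightarrow> 'a \<Rightarrow> 'a) \<Rightarrow> bool" where
  "generates S \<A> X v \<longleftrightarrow>
     is_flow S v \<and>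
     (\<forall>x\<in>S. integral_curve S \<A> X UNIV (\<lambda>t. v t x)) \<and>
     (\<forall>I \<gamma>. open I \<and> is_interval I \<and> 0 \<in> I \<and> integral_curve S \<A> X I \<gamma> \<longrightarrow>
        (\<forall>t\<in>I. \<gamma> t = v t (\<gamma> 0)))"

definition orbit :: "(real \<Rightarrow> 'a \<Rightarrow> 'a) \<Rightarrow> 'a \<Rightarrow> 'a set" where
  "orbit v x = range (\<lambda>t. v t x)"

definition sing :: "'a set \<Rightarrow> (real \<Rightarrow> 'a \<Rightarrow> 'a) \<Rightarrow> 'a set" where
  "sing S v = {x \<in> S. \<forall>t. v t x = x}"

definition wandering :: "'a::t2_space set \<Rightarrow> (real \<Rightarrow> 'a \<Rightarrow> 'a) \<Rightarrow> 'a \<Rightarrow> bool" where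
  "wandering S v x \<longleftrightarrow>
     (\<exists>U N. openin (top_of_set S) U \<and> x \<in> U \<and> N > 0 \<and> (\<forall>t>N. v t ` U \<inter> U = {}))"

definition non_wandering_flow :: "'a::t2_space set \<Rightarrow> (real \<Rightarrow> 'a \<Rightarrow> 'a) \<Rightarrow> bool" where
  "non_wandering_flow S v \<longleftrightarrow> (\<forall>x\<in>S. \<not> wandering S v x)"

definition totally_disconnected :: "'a::topological_space set \<Rightarrow> bool" where
  "totally_disconnected T \<longleftrightarrow> (\<forall>C\<subseteq>T. connected C \<longrightarrow> (\<forall>x\<in>C. \<forall>y\<in>C. x = y))"

end

theory Submission
  imports Defs
begin

text \<open>The idea is to stop the flow of \<open>X\<close> on a totally disconnected set that nevertheless meets every
orbit near some point, so that no orbit leaving a small neighbourhood of that point can come back.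

Choose \<open>p\<close> and a smooth \<open>g\<close> with \<open>X p g > 0\<close>. Near \<open>p\<close> the function \<open>g\<close> increases strictly along
orbits, so the level set \<open>\<Sigma>\<close> of \<open>g\<close> through \<open>p\<close>, intersected with a small chart disc, is a compact set that
every nearby orbit crosses, and crosses only once in a short time. The compact set \<open>\<Sigma>\<close> lies in a plane
chart and is therefore a continuous image of a closed subset \<open>D\<close> of the Cantor space
\<open>nat \<Rightarrow> bool\<close>, say by \<open>\<sigma>\<close>. With an injective continuous \<open>\<iota>\<close> from the Cantor space to short negative
times, \<open>a \<mapsto> v (\<iota> a) (\<sigma> a)\<close> is injective even if \<open>\<sigma>\<close> is not: different parameters are pushed off
\<open>\<Sigma>\<close> by different times. Its image \<open>K\<close> is homeomorphic to \<open>D\<close>, hence totally disconnected, and each orbit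
crossing \<open>\<Sigma>\<close> has met \<open>K\<close> shortly before (\<open>blocking_set\<close>). Only the compactness of \<open>\<Sigma>\<close> matters, not
its shape, so boundary points of the surface are treated like all others.

By a theorem of Whitney there is a smooth \<open>f\<close> with values in \<open>[0,1]\<close> that vanishes exactly on \<open>K\<close>
(\<open>smooth_zero_set_cutoff\<close>, \<open>smooth_fun_from_chart\<close>). The flow of \<open>f X\<close> is \<open>w t x = v (\<tau> t x) x\<close>, where
\<open>\<tau>\<close> solves the scalar equation \<open>\<tau>' = f (v \<tau> x)\<close> with \<open>\<tau> 0 x = 0\<close>. Although \<open>X\<close> is merely
continuous, the right-hand side is Lipschitz in \<open>\<tau>\<close>: its derivative is \<open>X f\<close>, which is bounded on the
compact surface. So Picard iteration applies, and so does uniqueness (\<open>time_change\<close>).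

An orbit of \<open>w\<close> never passes a point of \<open>K\<close>. To return to a small neighbourhood of \<open>p\<close> it would have
to cross \<open>K\<close>, so \<open>p\<close> is wandering (\<open>wandering_if_blocked\<close>). Orbits of \<open>w\<close> lie in orbits of \<open>v\<close>, and
the singular points of \<open>w\<close> are those of \<open>v\<close> together with \<open>K\<close>. As \<open>X g\<close> vanishes on the former and is positive on
\<open>K\<close>, no connected subset of their union meets both.\<close>

section \<open>Smooth maps between Euclidean spaces\<close>

lemma Ck_on_cong:
  assumes U: "open U"
  shows "(\<And>x. x \<in> U \<Longrightarrow> f x = g x) \<Longrightarrow> Ck_on k U f \<Longrightarrow> Ck_on k U g"
proof (induction k arbitrary: f g)
  case 0
  then show ?case by (auto cong: continuous_on_cong)
next
  case (Suc k)
  have d: "(g has_derivative frechet_derivative f (at x)) (at x)" if x: "x \<in> U" for x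
  proof -
    have "(f has_derivative frechet_derivative f (at x)) (at x)"
      using Suc.prems(2) x frechet_derivative_works by auto
    then show ?thesis
      by (rule has_derivative_transform_within_open[OF _ U x]) (use Suc.prems(1) in auto)
  qed
  have "Ck_on k U (\<lambda>x. frechet_derivative g (at x) h)" for h
    by (rule Suc.IH[of "\<lambda>x. frechet_derivative f (at x) h"])
      (use d frechet_derivative_at Suc.prems(2) in \<open>metis, auto\<close>)
  then show ?case
    using d by (auto simp: differentiable_def)
qed

text \<open>The definition speaks about the chosen \<open>frechet_derivative\<close>; this rule allows any explicit
candidate for the derivative.\<close>

lemma Ck_on_SucI:
  assumes U: "open U"
    and d: "\<And>x. x \<in> U \<Longrightarrow> (f has_derivative f' x) (at x)"
    and c: "\<And>h. Ck_on k U (\<lambda>x. f' x h)"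
  shows "Ck_on (Suc k) U f"
proof -
  have "Ck_on k U (\<lambda>x. frechet_derivative f (at x) h)" for h
    by (rule Ck_on_cong[OF U _ c[of h]]) (use d frechet_derivative_at in metis)
  then show ?thesis
    using d by (auto simp: differentiable_def)
qed

lemma Ck_on_Suc_derivative:
  "Ck_on (Suc k) U f \<Longrightarrow> x \<in> U \<Longrightarrow> (f has_derivative frechet_derivative f (at x)) (at x)"
  using frechet_derivative_works by auto

lemma Ck_on_continuous:
  assumes "Ck_on k U f"
  shows "continuous_on U f"
proof (cases k)
  case (Suc m)
  then have "f differentiable (at x within U)" if "x \<in> U" for x
    using assms that by (auto intro: differentiable_at_withinI)
  then show ?thesis
    by (simp add: differentiable_imp_continuous_on differentiable_on_def)
qed (use assms in auto)

lemma Ck_on_lower: "Ck_on (Suc k) U f \<Longrightarrow> Ck_on k U f"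
proof (induction k arbitrary: f)
  case 0
  then show ?case using Ck_on_continuous[OF 0] by simp
next
  case (Suc k)
  then show ?case by (metis Ck_on.simps(2))
qed

lemma Ck_on_partial: "(\<And>j. Ck_on j U f) \<Longrightarrow> Ck_on k U (\<lambda>x. frechet_derivative f (at x) h)"
  using Ck_on.simps(2) by blast

lemma Ck_on_subset: "Ck_on k U f \<Longrightarrow> V \<subseteq> U \<Longrightarrow> Ck_on k V f"
  by (induction k arbitrary: f) (auto intro: continuous_on_subset)

lemma Ck_on_const: "open U \<Longrightarrow> Ck_on k U (\<lambda>x. c)"
proof (induction k arbitrary: c)
  case (Suc k)
  then show ?case by (intro Ck_on_SucI[where f' = "\<lambda>x h. 0"]) (auto intro: derivative_eq_intros)
qed auto

lemma Ck_on_linear: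
  assumes "open U" "bounded_linear L"
  shows "Ck_on k U L"
proof (cases k)
  case 0
  then show ?thesis
    using assms linear_continuous_on by auto
next
  case (Suc m)
  show ?thesis unfolding Suc
    using assms by (intro Ck_on_SucI[where f' = "\<lambda>x. L"]) (auto intro: Ck_on_const bounded_linear_imp_has_derivative)
qed

lemma Ck_on_linear_compose:
  assumes U: "open U" and L: "bounded_linear L"
  shows "Ck_on k U f \<Longrightarrow> Ck_on k U (\<lambda>x. L (f x))"
proof (induction k arbitrary: f)
  case 0
  then show ?case
    using linear_continuous_on_compose L linear_conv_bounded_linear
    by (auto intro: bounded_linear.continuous_on)
next
  case (Suc k)
  show ?case
  proof (rule Ck_on_SucI[OF U])
    show "((\<lambda>x. L (f x)) has_derivative (\<lambda>h. L (frechet_derivative f (at x) h))) (at x)"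
      if "x \<in> U" for x
      by (rule bounded_linear.has_derivative[OF L Ck_on_Suc_derivative[OF Suc.prems that]])
  qed (use Suc in auto)
qed

lemma Ck_on_add:
  assumes U: "open U"
  shows "Ck_on k U f \<Longrightarrow> Ck_on k U g \<Longrightarrow> Ck_on k U (\<lambda>x. f x + g x)"
proof (induction k arbitrary: f g)
  case 0
  then show ?case by (auto intro: continuous_intros)
next
  case (Suc k)
  show ?case
    by (rule Ck_on_SucI[OF U has_derivative_add[OF Ck_on_Suc_derivative[OF Suc.prems(1)]
            Ck_on_Suc_derivative[OF Suc.prems(2)]]]) (use Suc in auto)
qed

lemma Ck_on_sum:
  assumes U: "open U"
  shows "(\<And>i. i \<in> A \<Longrightarrow> Ck_on k U (f i)) \<Longrightarrow> Ck_on k U (\<lambda>x. \<Sum>i\<in>A. f i x)"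
  by (induction A rule: infinite_finite_induct) (auto intro: Ck_on_const U Ck_on_add)

lemma Ck_on_mult:
  fixes f g :: "'a::euclidean_space \<Rightarrow> real"
  assumes U: "open U"
  shows "Ck_on k U f \<Longrightarrow> Ck_on k U g \<Longrightarrow> Ck_on k U (\<lambda>x. f x * g x)"
proof (induction k arbitrary: f g)
  case 0
  then show ?case by (auto intro: continuous_intros)
next
  case (Suc k)
  note lower = Ck_on_lower[OF Suc.prems(1)] Ck_on_lower[OF Suc.prems(2)]
  show ?case
    by (rule Ck_on_SucI[OF U has_derivative_mult[OF Ck_on_Suc_derivative[OF Suc.prems(1)]
            Ck_on_Suc_derivative[OF Suc.prems(2)]]])
      (use Suc lower in \<open>auto intro!: Ck_on_add[OF U]\<close>)
qed

text \<open>Expanding \<open>f' x h\<close> in the standard basis turns the chain rule into a finite sum of products of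
components of \<open>f'\<close> with partial derivatives of \<open>g\<close> composed with \<open>f\<close>, so the induction on the
order can be applied to each partial derivative of \<open>g\<close>.\<close>

lemma Ck_on_compose:
  fixes f :: "'a::euclidean_space \<Rightarrow> 'b::euclidean_space" and g :: "'b \<Rightarrow> real"
  assumes U: "open U" and V: "open V" and sub: "f ` U \<subseteq> V"
  shows "Ck_on k V g \<Longrightarrow> Ck_on k U f \<Longrightarrow> Ck_on k U (\<lambda>x. g (f x))"
proof (induction k arbitrary: g)
  case 0
  then show ?case using sub by (auto intro: continuous_on_compose2)
next
  case (Suc k)
  let ?f' = "\<lambda>x. frechet_derivative f (at x)" and ?g' = "\<lambda>y. frechet_derivative g (at y)"
  have "((\<lambda>x. g (f x)) has_derivative (\<lambda>h. \<Sum>i\<in>Basis. (?f' x h \<bullet> i) * ?g' (f x) i)) (at x)"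
    if x: "x \<in> U" for x
  proof -
    have g': "(g has_derivative ?g' (f x)) (at (f x))"
      using Ck_on_Suc_derivative[OF Suc.prems(1)] sub x by blast
    have "?g' (f x) (?f' x h) = (\<Sum>i\<in>Basis. (?f' x h \<bullet> i) * ?g' (f x) i)" for h
    proof -
      have l: "linear (?g' (f x))" using g' has_derivative_linear by blast
      have "?g' (f x) (?f' x h) = ?g' (f x) (\<Sum>i\<in>Basis. (?f' x h \<bullet> i) *\<^sub>R i)"
        by (simp add: euclidean_representation)
      also have "\<dots> = (\<Sum>i\<in>Basis. (?f' x h \<bullet> i) * ?g' (f x) i)"
        using l by (simp add: linear_sum linear_cmul)
      finally show ?thesis .
    qed
    then show ?thesis
      using has_derivative_compose[OF Ck_on_Suc_derivative[OF Suc.prems(2) x] g'] by simp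
  qed
  then show ?case
  proof (rule Ck_on_SucI[OF U])
    fix h
    show "Ck_on k U (\<lambda>x. \<Sum>i\<in>Basis. (?f' x h \<bullet> i) * ?g' (f x) i)"
    proof (intro Ck_on_sum[OF U] Ck_on_mult[OF U])
      fix i :: 'b
      show "Ck_on k U (\<lambda>x. ?f' x h \<bullet> i)"
        by (rule Ck_on_linear_compose[OF U bounded_linear_inner_left]) (use Suc.prems(2) in auto)
      show "Ck_on k U (\<lambda>x. ?g' (f x) i)"
        by (rule Suc.IH) (use Suc.prems(1) Ck_on_lower[OF Suc.prems(2)] in auto)
    qed
  qed
qed

section \<open>Closed sets as zero sets of smooth functions\<close>

text \<open>The function \<open>exp (-1/t)\<close>, continued by zero, is \<open>flat 0\<close>. The powers of \<open>t\<close> in the denominator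
make the family closed under differentiation.\<close>

definition flat :: "nat \<Rightarrow> real \<Rightarrow> real" where
  "flat m t = (if t > 0 then exp (- 1 / t) / t ^ m else 0)"

lemma flat_has_derivative:
  "(flat m has_real_derivative flat (m + 2) t - real m * flat (m + 1) t) (at t)"
proof -
  consider "t > 0" | "t < 0" | "t = 0" by linarith
  then show ?thesis
  proof cases
    case 1
    have e: "((\<lambda>t. exp (- 1 / t)) has_real_derivative exp (- 1 / t) / t\<^sup>2) (at t)"
      using 1 by (auto intro!: derivative_eq_intros simp: power2_eq_square)
    have "((\<lambda>t. exp (- 1 / t) / t ^ m) has_real_derivative
        (exp (- 1 / t) / t\<^sup>2 * t ^ m - exp (- 1 / t) * (real m * t ^ (m - 1))) / (t ^ m * t ^ m)) (at t)"
      using 1 DERIV_divide[OF e DERIV_pow, of m] by simp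
    also have "(exp (- 1 / t) / t\<^sup>2 * t ^ m - exp (- 1 / t) * (real m * t ^ (m - 1))) / (t ^ m * t ^ m)
        = flat (m + 2) t - real m * flat (m + 1) t"
      using 1 by (cases m) (simp_all add: flat_def field_simps power2_eq_square)
    finally have "((\<lambda>t. exp (- 1 / t) / t ^ m) has_real_derivative
        flat (m + 2) t - real m * flat (m + 1) t) (at t)" .
    then show ?thesis
      by (rule has_field_derivative_transform_within_open[of _ _ _ "{0<..}"])
        (use 1 in \<open>auto simp: flat_def\<close>)
  next
    case 2
    have "((\<lambda>t. 0) has_real_derivative 0) (at t)" by simp
    then have "(flat m has_real_derivative 0) (at t)"
      by (rule has_field_derivative_transform_within_open[of _ _ _ "{..<0}"])
        (use 2 in \<open>auto simp: flat_def\<close>)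
    then show ?thesis using 2 by (simp add: flat_def)
  next
    case 3
    have "((\<lambda>h. flat m h / h) \<longlongrightarrow> 0) (at_left 0)"
      by (rule tendsto_eventually) (auto simp: flat_def eventually_at_left_field intro: exI[of _ "-1"])
    moreover have "((\<lambda>h. flat m h / h) \<longlongrightarrow> 0) (at_right 0)"
    proof -
      have "((\<lambda>h. inverse h ^ (m + 1) / exp (inverse h)) \<longlongrightarrow> 0) (at_right (0::real))"
        by (rule filterlim_compose[OF tendsto_power_div_exp_0 filterlim_inverse_at_top_right])
      then show ?thesis
      proof (rule Lim_transform_eventually)
        show "\<forall>\<^sub>F h in at_right 0. inverse h ^ (m + 1) / exp (inverse h) = flat m h / h"
          using eventually_at_right_less[of 0]
          by eventually_elim (simp add: flat_def exp_minus field_simps)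
      qed
    qed
    ultimately have "((\<lambda>h. flat m h / h) \<longlongrightarrow> 0) (at 0)"
      by (rule filterlim_split_at)
    then show ?thesis
      using 3 by (simp add: has_field_derivative_iff flat_def)
  qed
qed

lemma Ck_on_flat: "Ck_on k UNIV (flat m)"
proof (induction k arbitrary: m)
  case 0
  then show ?case
    by (simp add: continuous_on_eq_continuous_at) (meson DERIV_isCont flat_has_derivative)
next
  case (Suc k)
  show ?case
  proof (rule Ck_on_SucI[OF open_UNIV])
    show "(flat m has_derivative (\<lambda>h. (flat (m + 2) t + (- real m) * flat (m + 1) t) * h)) (at t)" for t
      using flat_has_derivative[of m t] by (simp add: has_field_derivative_def)
    show "Ck_on k UNIV (\<lambda>t. (flat (m + 2) t + (- real m) * flat (m + 1) t) * h)" for h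
      by (intro Ck_on_mult Ck_on_add Ck_on_const open_UNIV Suc.IH)
  qed
qed

text \<open>A common bound for all iterated partial derivatives of order at most \<open>k\<close>. Only basis directions
occur, as there is no bound uniform in all directions.\<close>

primrec derivs_le :: "nat \<Rightarrow> real \<Rightarrow> ('a::euclidean_space \<Rightarrow> real) \<Rightarrow> bool" where
  "derivs_le 0 M f \<longleftrightarrow> (\<forall>x. \<bar>f x\<bar> \<le> M)"
| "derivs_le (Suc k) M f \<longleftrightarrow>
     (\<forall>x. \<bar>f x\<bar> \<le> M) \<and> (\<forall>i\<in>Basis. derivs_le k M (\<lambda>x. frechet_derivative f (at x) i))"

lemma derivs_le_mono: "derivs_le k M f \<Longrightarrow> M \<le> N \<Longrightarrow> derivs_le k N f"
  by (induction k arbitrary: f) (auto intro: order_trans)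

lemma derivs_le_lower: "derivs_le n M f \<Longrightarrow> k \<le> n \<Longrightarrow> derivs_le k M f"
proof (induction k arbitrary: n f)
  case 0
  then show ?case by (cases n) auto
next
  case (Suc k)
  then obtain m where "n = Suc m" by (cases n) auto
  then show ?case using Suc by auto
qed

lemma derivs_le_cmult:
  "(\<And>j. Ck_on j UNIV f) \<Longrightarrow> derivs_le k M f \<Longrightarrow> derivs_le k (\<bar>c\<bar> * M) (\<lambda>x. c * f x)"
proof (induction k arbitrary: f)
  case 0
  then show ?case by (auto simp: abs_mult intro: mult_left_mono)
next
  case (Suc k)
  have "frechet_derivative (\<lambda>x. c * f x) (at x) = (\<lambda>h. c * frechet_derivative f (at x) h)" for x
    by (rule frechet_derivative_at[symmetric])
      (use Ck_on_Suc_derivative[OF Suc.prems(1), of x] in \<open>auto intro: has_derivative_mult_right\<close>)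
  then show ?case
    using Suc.prems(2) Suc.IH[OF Ck_on_partial[OF Suc.prems(1)]]
    by (auto simp: abs_mult intro: mult_left_mono)
qed

lemma derivs_le_compact_support:
  fixes f :: "'a::euclidean_space \<Rightarrow> real"
  assumes C: "compact C"
  shows "(\<And>j. Ck_on j UNIV f) \<Longrightarrow> (\<And>x. x \<notin> C \<Longrightarrow> f x = 0) \<Longrightarrow> \<exists>M. derivs_le k M f"
proof (induction k arbitrary: f)
  case 0
  have "continuous_on C f"
    using 0(1)[of 0] continuous_on_subset by auto
  then have "bounded (f ` C)"
    using C compact_continuous_image compact_imp_bounded by blast
  then obtain B where B: "\<And>x. x \<in> C \<Longrightarrow> \<bar>f x\<bar> \<le> B"
    unfolding bounded_iff by auto
  have "\<bar>f x\<bar> \<le> max B 0" for x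
    using B[of x] 0(2)[of x] by (cases "x \<in> C") auto
  then show ?case by auto
next
  case (Suc k)
  have vanish: "frechet_derivative f (at x) h = 0" if x: "x \<notin> C" for x h
  proof -
    have "(f has_derivative (\<lambda>h. 0)) (at x)"
      by (rule has_derivative_transform_within_open[of "\<lambda>x. 0" _ _ UNIV "- C"])
        (use C x Suc.prems(2) in \<open>auto simp: compact_imp_closed open_Compl\<close>)
    then show ?thesis using frechet_derivative_at by metis
  qed
  have "\<exists>M. derivs_le k M (\<lambda>x. frechet_derivative f (at x) i)" for i
    by (rule Suc.IH) (use Ck_on_partial[OF Suc.prems(1)] vanish in auto)
  then obtain M where M: "\<And>i. derivs_le k (M i) (\<lambda>x. frechet_derivative f (at x) i)"
    by metis
  have "continuous_on C f"
    using Suc.prems(1)[of 0] continuous_on_subset by auto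
  then have "bounded (f ` C)"
    using C compact_continuous_image compact_imp_bounded by blast
  then obtain B where B: "\<And>x. x \<in> C \<Longrightarrow> \<bar>f x\<bar> \<le> B"
    unfolding bounded_iff by auto
  define N where "N = \<bar>B\<bar> + (\<Sum>i\<in>(Basis::'a set). \<bar>M i\<bar>)"
  have "\<bar>f x\<bar> \<le> N" for x
  proof -
    have "0 \<le> (\<Sum>i\<in>(Basis::'a set). \<bar>M i\<bar>)" by (simp add: sum_nonneg)
    moreover have "\<bar>f x\<bar> \<le> \<bar>B\<bar>"
      using B[of x] Suc.prems(2)[of x] by (cases "x \<in> C") auto
    ultimately show ?thesis unfolding N_def by linarith
  qed
  moreover have "derivs_le k N (\<lambda>x. frechet_derivative f (at x) i)" if "i \<in> Basis" for i
  proof (rule derivs_le_mono[OF M])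
    have "\<bar>M i\<bar> \<le> (\<Sum>i\<in>(Basis::'a set). \<bar>M i\<bar>)"
      using that by (intro member_le_sum) auto
    then show "M i \<le> N" unfolding N_def by linarith
  qed
  ultimately show ?case by auto
qed

text \<open>A Weierstrass test for all derivatives: the series of partial derivatives satisfies the hypotheses
again with one order less, and it converges uniformly, so term-by-term differentiation is allowed.\<close>

lemma Ck_on_suminf:
  fixes f :: "nat \<Rightarrow> 'a::euclidean_space \<Rightarrow> real"
  shows "(\<And>n j. Ck_on j UNIV (f n)) \<Longrightarrow> (\<And>n. derivs_le k (C n) (f n)) \<Longrightarrow> summable C \<Longrightarrow>
    Ck_on k UNIV (\<lambda>x. \<Sum>n. f n x)"
proof (induction k arbitrary: f)
  case 0
  have "uniform_limit UNIV (\<lambda>n x. \<Sum>i<n. f i x) (\<lambda>x. \<Sum>i. f i x) sequentially"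
    by (rule Weierstrass_m_test[OF _ \<open>summable C\<close>]) (use 0(2) in auto)
  moreover have "\<forall>\<^sub>F n in sequentially. continuous_on UNIV (\<lambda>x. \<Sum>i<n. f i x)"
    using 0(1)[of 0] by (auto intro!: continuous_on_sum always_eventually)
  ultimately show ?case
    using uniform_limit_theorem by fastforce
next
  case (Suc k)
  let ?d = "\<lambda>n x. frechet_derivative (f n) (at x)"
  let ?D = "\<lambda>x h. \<Sum>i\<in>Basis. (h \<bullet> i) * (\<Sum>n. ?d n x i)"
  have der: "(f n has_derivative ?d n x) (at x)" for n x
    using Ck_on_Suc_derivative[OF Suc.prems(1)] by blast
  have bd: "\<bar>?d n x i\<bar> \<le> C n" if "i \<in> Basis" for n x i
    using derivs_le_lower[of k "C n" "\<lambda>x. ?d n x i" 0] Suc.prems(2)[of n] that by auto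
  have expand: "?d n x h = (\<Sum>i\<in>Basis. (h \<bullet> i) * ?d n x i)" for n x h
  proof -
    have l: "linear (?d n x)" using der has_derivative_linear by blast
    have "?d n x h = ?d n x (\<Sum>i\<in>Basis. (h \<bullet> i) *\<^sub>R i)"
      by (simp add: euclidean_representation)
    then show ?thesis using l by (simp add: linear_sum linear_cmul)
  qed
  have conv: "\<forall>\<^sub>F n in sequentially. \<forall>x\<in>UNIV. \<forall>h. norm ((\<Sum>j<n. ?d j x h) - ?D x h) \<le> e * norm h"
    if e: "e > 0" for e
  proof -
    let ?m = "real (DIM('a))"
    have ul: "uniform_limit UNIV (\<lambda>n x. \<Sum>j<n. ?d j x i) (\<lambda>x. \<Sum>j. ?d j x i) sequentially"
      if "i \<in> Basis" for i
      by (rule Weierstrass_m_test[OF _ \<open>summable C\<close>]) (use bd that in auto)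
    have "\<forall>\<^sub>F n in sequentially. \<forall>i\<in>Basis. \<forall>x\<in>UNIV. dist (\<Sum>j<n. ?d j x i) (\<Sum>j. ?d j x i) < e / ?m"
      unfolding eventually_ball_finite_distrib[OF finite_Basis]
      using ul e by (auto simp: uniform_limit_iff)
    then show ?thesis
    proof eventually_elim
      case (elim n)
      have "norm ((\<Sum>j<n. ?d j x h) - ?D x h) \<le> e * norm h" for x h
      proof -
        have "(\<Sum>j<n. ?d j x h) = (\<Sum>i\<in>Basis. (h \<bullet> i) * (\<Sum>j<n. ?d j x i))"
          by (subst expand) (simp add: sum_distrib_left sum.swap[of _ "{..<n}"])
        then have "(\<Sum>j<n. ?d j x h) - ?D x h
            = (\<Sum>i\<in>Basis. (h \<bullet> i) * ((\<Sum>j<n. ?d j x i) - (\<Sum>j. ?d j x i)))"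
          by (simp add: sum_subtractf right_diff_distrib)
        also have "norm \<dots> \<le> (\<Sum>i\<in>(Basis::'a set). norm h * (e / ?m))"
        proof (rule sum_norm_le)
          fix i :: 'a assume i: "i \<in> Basis"
          have "\<bar>(\<Sum>j<n. ?d j x i) - (\<Sum>j. ?d j x i)\<bar> \<le> e / ?m"
            using elim i by (auto simp: dist_real_def less_imp_le)
          then show "norm ((h \<bullet> i) * ((\<Sum>j<n. ?d j x i) - (\<Sum>j. ?d j x i))) \<le> norm h * (e / ?m)"
            unfolding real_norm_def abs_mult
            by (intro mult_mono) (use i Basis_le_norm in auto)
        qed
        also have "\<dots> = e * norm h" by simp
        finally show ?thesis .
      qed
      then show ?case by blast
    qed
  qed
  have summ: "summable (\<lambda>n. f n x)" for x
  proof (rule summable_comparison_test'[OF \<open>summable C\<close>])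
    show "norm (f n x) \<le> C n" for n using Suc.prems(2)[of n] by simp
  qed
  obtain g where g: "\<And>x. (\<lambda>n. f n x) sums g x" "\<And>x. (g has_derivative ?D x) (at x)"
    using has_derivative_series[OF convex_UNIV der conv UNIV_I summable_sums[OF summ]] by auto
  then have "g = (\<lambda>x. \<Sum>n. f n x)"
    using sums_unique by blast
  then have D: "((\<lambda>x. \<Sum>n. f n x) has_derivative ?D x) (at x)" for x
    using g(2) by simp
  show ?case
  proof (rule Ck_on_SucI[OF open_UNIV D])
    fix h
    show "Ck_on k UNIV (\<lambda>x. ?D x h)"
      using Suc.prems(2)
      by (intro Ck_on_sum Ck_on_mult Ck_on_const open_UNIV Suc.IH[OF _ _ Suc.prems(3)]
          Ck_on_partial[OF Suc.prems(1)]) auto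
  qed
qed

lemma Ck_on_flat_sphere:
  fixes a :: "'a::euclidean_space"
  shows "Ck_on k UNIV (\<lambda>x. flat 0 (\<alpha> + \<beta> * ((x - a) \<bullet> (x - a))))"
proof -
  have "Ck_on k UNIV (\<lambda>x. x \<bullet> b + (- a) \<bullet> b)" for b
    by (intro Ck_on_add Ck_on_const Ck_on_linear bounded_linear_inner_left open_UNIV)
  then have lin: "Ck_on k UNIV (\<lambda>x. (x - a) \<bullet> b)" for b
    by (simp add: inner_diff_left)
  have "Ck_on k UNIV (\<lambda>x. \<alpha> + \<beta> * (\<Sum>b\<in>Basis. ((x - a) \<bullet> b) * ((x - a) \<bullet> b)))"
    by (intro Ck_on_add Ck_on_mult Ck_on_sum Ck_on_const lin open_UNIV)
  then have "Ck_on k UNIV (\<lambda>x. \<alpha> + \<beta> * ((x - a) \<bullet> (x - a)))"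
    by (simp add: euclidean_inner[of "x - a" "x - a" for x])
  then show ?thesis
    by (intro Ck_on_compose[OF open_UNIV open_UNIV _ Ck_on_flat]) auto
qed

text \<open>Whitney's theorem. The complement of \<open>K\<close> is a countable union of balls. Each ball is the set where
a smooth bump is positive, and the bumps are added with weights that make the derivatives of
the \<open>n\<close>-th term up to order \<open>n\<close> at most \<open>2\<^sup>-\<^sup>n\<close>, so that for every order all but finitely many
terms are dominated by a geometric series.\<close>

lemma smooth_zero_set:
  fixes K :: "'a::euclidean_space set"
  assumes K: "closed K"
  obtains F :: "'a \<Rightarrow> real" where "\<And>k. Ck_on k UNIV F" "\<And>x. 0 \<le> F x" "\<And>x. F x = 0 \<longleftrightarrow> x \<in> K"
proof -
  define \<B> where "\<B> = {ball a r | a r. ball a r \<inter> K = {}}"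
  have "\<And>B. B \<in> \<B> \<Longrightarrow> open B" unfolding \<B>_def by auto
  then obtain \<C> where \<C>: "\<C> \<subseteq> \<B>" "countable \<C>" "\<Union>\<C> = \<Union>\<B>"
    by (rule Lindelof)
  have cover: "\<Union>\<B> = - K"
  proof (intro equalityI subsetI)
    fix x assume "x \<in> - K"
    then obtain r where "r > 0" "ball x r \<subseteq> - K"
      using open_contains_ball[of "- K"] K by auto
    then have "ball x r \<in> \<B>" "x \<in> ball x r" unfolding \<B>_def by auto
    then show "x \<in> \<Union>\<B>" by blast
  qed (unfold \<B>_def, blast)
  \<comment> \<open>An enumeration by the natural numbers needs a nonempty family; the union does not change.\<close>
  define \<C>' where "\<C>' = insert {} \<C>"
  have \<C>': "countable \<C>'" "\<C>' \<noteq> {}" using \<C>(2) by (simp_all add: \<C>'_def)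
  have "ball (0::'a) 0 \<in> \<B>" unfolding \<B>_def
    by (intro CollectI exI[of _ "0::'a"] exI[of _ "0::real"] conjI) simp_all
  then have "{} \<in> \<B>" by simp
  then have sub: "\<C>' \<subseteq> \<B>" using \<C>(1) by (simp add: \<C>'_def)
  define B where "B = from_nat_into \<C>'"
  have rangeB: "range B = \<C>'" unfolding B_def by (rule range_from_nat_into[OF \<C>'(2,1)])
  have "B n \<in> \<B>" for n using sub rangeB by blast
  then have "\<forall>n. \<exists>a r. B n = ball a r \<and> B n \<inter> K = {}"
    unfolding \<B>_def by blast
  then obtain a r where ar: "\<And>n. B n = ball (a n) (r n)" "\<And>n. B n \<inter> K = {}" by metis
  have UB: "(\<Union>n. B n) = - K"
    unfolding rangeB \<C>'_def using \<C>(3) cover by simp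
  define \<beta> where "\<beta> n x = (if r n > 0 then flat 0 ((r n)\<^sup>2 + (-1) * ((x - a n) \<bullet> (x - a n))) else 0)" for n x
  have \<beta>: "Ck_on k UNIV (\<beta> n)" for k n
    unfolding \<beta>_def using Ck_on_flat_sphere[of k "(r n)\<^sup>2" "-1" "a n"] Ck_on_const[OF open_UNIV]
    by (cases "r n > 0") auto
  have \<beta>0: "0 \<le> \<beta> n x" for n x by (simp add: \<beta>_def flat_def)
  have \<beta>pos: "\<beta> n x > 0 \<longleftrightarrow> x \<in> B n" for n x
  proof -
    have "(x - a n) \<bullet> (x - a n) = (dist (a n) x)\<^sup>2"
      by (simp add: dist_norm norm_minus_commute power2_norm_eq_inner)
    moreover have "(dist (a n) x)\<^sup>2 < (r n)\<^sup>2 \<longleftrightarrow> dist (a n) x < r n" if "r n > 0"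
      using that power_mono_iff[of "r n" "dist (a n) x" 2] by (simp add: linorder_not_le[symmetric])
    moreover have "\<not> dist (a n) x < r n" if "\<not> r n > 0"
      using that zero_le_dist[of "a n" x] by linarith
    ultimately show ?thesis unfolding \<beta>_def ar by (auto simp: flat_def)
  qed
  have \<beta>out: "\<beta> n x = 0" if "x \<notin> cball (a n) (r n)" for n x
  proof -
    have "x \<notin> B n" using that unfolding ar by simp
    then show ?thesis using \<beta>pos[of n x] \<beta>0[of n x] by linarith
  qed
  have "\<exists>M>0. derivs_le n M (\<beta> n)" for n
  proof -
    have "\<beta> n x = 0" if "x \<notin> cball (a n) (r n)" for x
      using that \<beta>out by simp
    then obtain M where "derivs_le n M (\<beta> n)"
      using derivs_le_compact_support[OF compact_cball \<beta>] by blast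
    then have "derivs_le n (\<bar>M\<bar> + 1) (\<beta> n)" by (rule derivs_le_mono) linarith
    then show ?thesis by (intro exI[of _ "\<bar>M\<bar> + 1"]) auto
  qed
  then obtain M where M: "\<And>n. M n > 0" "\<And>n. derivs_le n (M n) (\<beta> n)" by metis
  \<comment> \<open>The bump of index \<open>n\<close> is scaled by its own derivatives up to order \<open>n\<close>.\<close>
  define c where "c n = (1/2) ^ n / M n" for n
  have c: "c n > 0" for n using M by (simp add: c_def)
  let ?f = "\<lambda>n x. c n * \<beta> n x"
  have f: "Ck_on k UNIV (?f n)" for k n
    by (intro Ck_on_mult Ck_on_const \<beta> open_UNIV)
  have bd: "derivs_le n ((1/2) ^ n) (?f n)" for n
    using derivs_le_cmult[OF \<beta> M(2), of n "c n"] M(1)[of n] c[of n] by (simp add: c_def)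
  define F where "F x = (\<Sum>n. ?f n x)" for x
  show ?thesis
  proof
    fix k
    have "\<exists>C. derivs_le k C (?f n) \<and> (k \<le> n \<longrightarrow> C = (1/2) ^ n)" for n
    proof (cases "k \<le> n")
      case True
      then show ?thesis using derivs_le_lower[OF bd] by blast
    next
      case False
      have "?f n x = 0" if "x \<notin> cball (a n) (r n)" for x
        using that \<beta>out by simp
      then show ?thesis
        using derivs_le_compact_support[OF compact_cball f] False by blast
    qed
    then obtain C where C: "\<And>n. derivs_le k (C n) (?f n)" "\<And>n. k \<le> n \<Longrightarrow> C n = (1/2) ^ n"
      by metis
    have "summable C"
      by (rule summable_cong[THEN iffD2, OF _ summable_geometric[of "1/2::real"]])
        (use C(2) in \<open>auto simp: eventually_sequentially\<close>)
    then show "Ck_on k UNIV F"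
      unfolding F_def by (rule Ck_on_suminf[OF f C(1)])
  next
    fix x
    have summ: "summable (\<lambda>n. ?f n x)"
    proof (rule summable_comparison_test'[OF summable_geometric[of "1/2::real"]])
      show "norm (?f n x) \<le> (1/2) ^ n" for n
        using derivs_le_lower[OF bd[of n], of 0] by simp
    qed simp
    have nn: "0 \<le> ?f n x" for n using c[of n] \<beta>0[of n x] by simp
    show "0 \<le> F x" unfolding F_def by (rule suminf_nonneg[OF summ nn])
    have "F x = 0 \<longleftrightarrow> (\<forall>n. ?f n x = 0)"
      unfolding F_def by (rule suminf_eq_zero_iff[OF summ nn])
    also have "\<dots> \<longleftrightarrow> (\<forall>n. \<not> \<beta> n x > 0)"
    proof -
      have "?f n x = 0 \<longleftrightarrow> \<not> \<beta> n x > 0" for n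
        using c[of n] \<beta>0[of n x] by auto
      then show ?thesis by blast
    qed
    also have "\<dots> \<longleftrightarrow> x \<in> K" using \<beta>pos UB by blast
    finally show "F x = 0 \<longleftrightarrow> x \<in> K" .
  qed
qed

text \<open>To make the function equal to \<open>1\<close> far away, a term that vanishes on the inner ball and is at least \<open>\<delta>\<close>
outside the outer one is added, and the sum is composed with \<open>t \<mapsto> 1 - e * flat 0 (1 - t / \<delta>)\<close>. This
maps \<open>0\<close>, and no other nonnegative number, to \<open>0\<close>, and everything from \<open>\<delta>\<close> on to \<open>1\<close>.\<close>

lemma smooth_zero_set_cutoff:
  fixes K :: "'a::euclidean_space set"
  assumes K: "closed K" "K \<subseteq> cball a r'" and r: "0 \<le> r'" "r' < r"
  obtains F :: "'a \<Rightarrow> real" where "\<And>k. Ck_on k UNIV F" "\<And>x. 0 \<le> F x" "\<And>x. F x \<le> 1"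
    "\<And>x. F x = 0 \<longleftrightarrow> x \<in> K" "\<And>x. r \<le> dist a x \<Longrightarrow> F x = 1"
proof -
  obtain G :: "'a \<Rightarrow> real" where G: "\<And>k. Ck_on k UNIV G" "\<And>x. 0 \<le> G x" "\<And>x. G x = 0 \<longleftrightarrow> x \<in> K"
    using smooth_zero_set[OF K(1)] by blast
  define b where "b x = flat 0 (- r'\<^sup>2 + 1 * ((x - a) \<bullet> (x - a)))" for x
  have dist: "(x - a) \<bullet> (x - a) = (dist a x)\<^sup>2" for x
    by (metis dist_commute dist_norm power2_norm_eq_inner)
  define \<delta> where "\<delta> = flat 0 (r\<^sup>2 - r'\<^sup>2)"
  have less: "r'\<^sup>2 < r\<^sup>2" using r by (simp add: power_strict_mono)
  then have \<delta>: "\<delta> > 0" by (simp add: \<delta>_def flat_def)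
  have b0: "b x \<ge> 0" for x by (simp add: b_def flat_def)
  have bK: "b x = 0" if "x \<in> K" for x
  proof -
    have "dist a x \<le> r'" using K(2) that by auto
    then have "(dist a x)\<^sup>2 \<le> r'\<^sup>2" by (simp add: power_mono)
    then show ?thesis by (simp add: b_def dist flat_def)
  qed
  have bfar: "b x \<ge> \<delta>" if "r \<le> dist a x" for x
  proof -
    have le: "r\<^sup>2 \<le> (dist a x)\<^sup>2" using r that by (intro power_mono) auto
    then have "1 / ((dist a x)\<^sup>2 - r'\<^sup>2) \<le> 1 / (r\<^sup>2 - r'\<^sup>2)"
      using less by (intro divide_left_mono) auto
    then show ?thesis
      using less le by (simp add: b_def dist flat_def \<delta>_def)
  qed
  define F where "F x = 1 + (- exp 1) * flat 0 (1 + (- 1 / \<delta>) * (G x + b x))" for x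
  show ?thesis
  proof
    fix k
    have "Ck_on k UNIV b" unfolding b_def by (rule Ck_on_flat_sphere)
    then have "Ck_on k UNIV (\<lambda>x. 1 + (- 1 / \<delta>) * (G x + b x))"
      by (intro Ck_on_add Ck_on_mult Ck_on_const G open_UNIV)
    then have "Ck_on k UNIV (\<lambda>x. flat 0 (1 + (- 1 / \<delta>) * (G x + b x)))"
      by (intro Ck_on_compose[OF open_UNIV open_UNIV _ Ck_on_flat]) auto
    then show "Ck_on k UNIV F"
      unfolding F_def by (intro Ck_on_add Ck_on_mult Ck_on_const open_UNIV)
  next
    fix x
    define u where "u = 1 + (- 1 / \<delta>) * (G x + b x)"
    have u1: "u \<le> 1" using \<delta> G(2)[of x] b0[of x] by (simp add: u_def)
    have F: "F x = 1 - exp 1 * flat 0 u" by (simp add: F_def u_def)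
    have f: "exp 1 * flat 0 u = (if u > 0 then exp (1 - 1 / u) else 0)"
      by (simp add: flat_def flip: exp_add)
    have le0: "1 - 1 / u \<le> 0" if "u > 0" using that u1 by (simp add: field_simps)
    show "0 \<le> F x" using F f le0 by auto
    show "F x \<le> 1" using F f by auto
    have "F x = 0 \<longleftrightarrow> u = 1" unfolding F f using u1 by auto
    also have "\<dots> \<longleftrightarrow> G x + b x = 0" using \<delta> by (simp add: u_def)
    also have "\<dots> \<longleftrightarrow> x \<in> K" using G(2,3)[of x] b0[of x] bK[of x] by auto
    finally show "F x = 0 \<longleftrightarrow> x \<in> K" .
    show "F x = 1" if "r \<le> dist a x"
    proof -
      have "u \<le> 0" using \<delta> bfar[OF that] G(2)[of x] by (simp add: u_def field_simps)
      then show ?thesis using F f by auto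
    qed
  qed
qed

section \<open>Scalar differential equations with a parameter\<close>

text \<open>A form of Gronwall's lemma: \<open>z\<^sup>2 exp (-2 L t)\<close> does not increase. For times before \<open>t0\<close> the argument
is applied to the reflected function.\<close>

lemma linear_growth_zero:
  fixes z :: "real \<Rightarrow> real"
  assumes I: "is_interval I" and t0: "t0 \<in> I" "z t0 = 0"
    and d: "\<And>t. t \<in> I \<Longrightarrow> (z has_real_derivative z' t) (at t)"
    and b: "\<And>t. t \<in> I \<Longrightarrow> \<bar>z' t\<bar> \<le> L * \<bar>z t\<bar>"
    and t: "t \<in> I"
  shows "z t = 0"
proof -
  have forward: "y t1 = 0"
    if "a \<le> t1" "y a = 0" and dy: "\<And>s. a \<le> s \<Longrightarrow> s \<le> t1 \<Longrightarrow> (y has_real_derivative y' s) (at s)"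
      and dom: "\<And>s. a \<le> s \<Longrightarrow> s \<le> t1 \<Longrightarrow> \<bar>y' s\<bar> \<le> L * \<bar>y s\<bar>" for y y' :: "real \<Rightarrow> real" and a t1
  proof -
    define E where "E s = (y s)\<^sup>2 * exp (- 2 * L * s)" for s
    have "E t1 \<le> E a"
    proof (rule DERIV_nonpos_imp_nonincreasing[OF \<open>a \<le> t1\<close>])
      fix s assume s: "a \<le> s" "s \<le> t1"
      have "(E has_real_derivative (2 * (y s * y' s) - 2 * L * (y s)\<^sup>2) * exp (- 2 * L * s)) (at s)"
        unfolding E_def using dy[OF s]
        by (auto intro!: derivative_eq_intros simp: algebra_simps power2_eq_square)
      moreover have "y s * y' s \<le> L * (y s)\<^sup>2"
      proof -
        have "y s * y' s \<le> \<bar>y s\<bar> * \<bar>y' s\<bar>" by (metis abs_ge_self abs_mult)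
        also have "\<dots> \<le> \<bar>y s\<bar> * (L * \<bar>y s\<bar>)" using dom[OF s] by (intro mult_left_mono) auto
        also have "\<dots> = L * (y s)\<^sup>2" by (simp add: power2_eq_square)
        finally show ?thesis .
      qed
      ultimately show "\<exists>D. (E has_real_derivative D) (at s) \<and> D \<le> 0"
        by (intro exI[of _ "(2 * (y s * y' s) - 2 * L * (y s)\<^sup>2) * exp (- 2 * L * s)"] conjI)
          (simp_all add: mult_nonpos_nonneg)
    qed
    then have "(y t1)\<^sup>2 * exp (- 2 * L * t1) \<le> 0"
      using \<open>y a = 0\<close> by (simp add: E_def)
    then have "(y t1)\<^sup>2 \<le> 0" by (simp add: mult_le_0_iff)
    then show ?thesis by simp
  qed
  show ?thesis
  proof (cases "t0 \<le> t")
    case True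
    have "s \<in> I" if "t0 \<le> s" "s \<le> t" for s
      using I t0 t that mem_is_interval_1_I by blast
    then show ?thesis using d b by (intro forward[of t0 t z z'] True t0(2)) auto
  next
    case False
    have sI: "- s \<in> I" if "- t0 \<le> s" "s \<le> - t" for s
      using mem_is_interval_1_I[OF I t t0(1), of "- s"] that by simp
    have "z (- (- t)) = 0"
    proof (rule forward[of "- t0" "- t" "\<lambda>s. z (- s)" "\<lambda>s. - z' (- s)"])
      fix s assume s: "- t0 \<le> s" "s \<le> - t"
      show "((\<lambda>s. z (- s)) has_real_derivative - z' (- s)) (at s)"
        using DERIV_chain2[OF d[OF sI[OF s]] DERIV_minus[OF DERIV_ident]] by simp
      show "\<bar>- z' (- s)\<bar> \<le> L * \<bar>z (- s)\<bar>" using b[OF sI[OF s]] by simp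
    qed (use False t0 in auto)
    then show ?thesis by simp
  qed
qed

lemma scalar_ode_unique:
  fixes y1 y2 :: "real \<Rightarrow> real"
  assumes I: "is_interval I" and t0: "t0 \<in> I" "y1 t0 = y2 t0"
    and lip: "\<And>u v. \<bar>h u - h v\<bar> \<le> L * \<bar>u - v\<bar>"
    and y1: "\<And>t. t \<in> I \<Longrightarrow> (y1 has_real_derivative h (y1 t)) (at t)"
    and y2: "\<And>t. t \<in> I \<Longrightarrow> (y2 has_real_derivative h (y2 t)) (at t)"
    and t: "t \<in> I"
  shows "y1 t = y2 t"
proof -
  have "y1 t - y2 t = 0"
    by (rule linear_growth_zero[OF I t0(1), of "\<lambda>t. y1 t - y2 t" "\<lambda>t. h (y1 t) - h (y2 t)" L])
      (use t0 lip y1 y2 t in \<open>auto intro: DERIV_diff\<close>)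
  then show ?thesis by simp
qed

text \<open>Integrating over the unit interval instead of \<open>[0, t]\<close> treats both signs of \<open>t\<close> at once and
moves the dependence on \<open>t\<close> into the integrand, where continuity in parameters is known.\<close>

lemma unit_integral_antiderivative:
  fixes h :: "real \<Rightarrow> real"
  assumes h: "continuous_on UNIV h"
  shows "((\<lambda>t. integral {0..1} (\<lambda>r. t * h (t * r))) has_real_derivative h t) (at t)"
proof -
  have "isCont h x" for x using h continuous_on_eq_continuous_at open_UNIV by blast
  then obtain F where F: "\<And>x. (F has_vector_derivative h x) (at x)"
    using einterval_antiderivative[of "-\<infinity>" "\<infinity>" h] by auto
  then have F': "\<And>x. (F has_real_derivative h x) (at x)"
    by (simp add: has_real_derivative_iff_has_vector_derivative)
  have "integral {0..1} (\<lambda>r. t * h (t * r)) = F t - F 0" for t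
  proof -
    have "((\<lambda>r. t * h (t * r)) has_integral F (t * 1) - F (t * 0)) {0..1}"
    proof (rule fundamental_theorem_of_calculus)
      fix x :: real assume "x \<in> {0..1}"
      have "((\<lambda>r. F (t * r)) has_real_derivative h (t * x) * t) (at x)"
        by (rule DERIV_chain2[OF F']) (auto intro!: derivative_eq_intros)
      then show "((\<lambda>r. F (t * r)) has_vector_derivative t * h (t * x)) (at x within {0..1})"
        by (simp add: has_real_derivative_iff_has_vector_derivative mult.commute
            has_vector_derivative_at_within)
    qed simp
    then have "integral {0..1} (\<lambda>r. t * h (t * r)) = F (t * 1) - F (t * 0)"
      by (rule integral_unique)
    then show ?thesis by simp
  qed
  then show ?thesis
    using DERIV_diff[OF F' DERIV_const] by simp
qed

lemma continuous_on_time_space: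
  assumes "continuous_on (UNIV \<times> S) (\<lambda>(t, x). z t x)"
    and "continuous_on A f" "continuous_on A g" "\<And>q. q \<in> A \<Longrightarrow> g q \<in> S"
  shows "continuous_on A (\<lambda>q. z (f q) (g q))"
proof -
  have "continuous_on A (\<lambda>q. (\<lambda>(t, x). z t x) (f q, g q))"
    by (rule continuous_on_compose2[OF assms(1)]) (use assms in \<open>auto intro: continuous_on_Pair\<close>)
  then show ?thesis by simp
qed

text \<open>Picard iteration with a parameter. The successive differences are bounded by the terms of an
exponential series, uniformly on \<open>[-R, R] \<times> S\<close>; hence the limit is jointly continuous and can be taken
under the integral sign. The Lipschitz bound is global, so the solutions exist for all times.\<close>

lemma picard:
  fixes S :: "'a::t2_space set" and a :: "real \<Rightarrow> 'a \<Rightarrow> real"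
  assumes cont: "continuous_on (UNIV \<times> S) (\<lambda>(s, x). a s x)"
    and lip: "\<And>x s s'. x \<in> S \<Longrightarrow> \<bar>a s x - a s' x\<bar> \<le> L * \<bar>s - s'\<bar>"
    and bdd: "\<And>x s. x \<in> S \<Longrightarrow> \<bar>a s x\<bar> \<le> M"
  obtains \<tau> where "continuous_on (UNIV \<times> S) (\<lambda>(t, x). \<tau> t x)"
    "\<And>x. x \<in> S \<Longrightarrow> \<tau> 0 x = 0"
    "\<And>x t. x \<in> S \<Longrightarrow> ((\<lambda>t. \<tau> t x) has_real_derivative a (\<tau> t x) x) (at t)"
proof (cases "S = {}")
  case True
  then show ?thesis using that[of "\<lambda>t x. 0"] by auto
next
  case False
  then obtain x0 where x0: "x0 \<in> S" by blast
  have L: "0 \<le> L" using lip[OF x0, of 1 0] by auto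
  define step where "step = (\<lambda>y t x. integral {0..1} (\<lambda>r. t * a (y (t * r) x) x))"
  define y where "y n = (step ^^ n) (\<lambda>t x. 0)" for n
  have ySuc: "y (Suc n) = step (y n)" for n by (simp add: y_def)
  have integrand_cont: "continuous_on ((UNIV \<times> S) \<times> cbox 0 1) (\<lambda>(p, r). fst p * a (z (fst p * r) (snd p)) (snd p))"
    if z: "continuous_on (UNIV \<times> S) (\<lambda>(t, x). z t x)" for z :: "real \<Rightarrow> 'a \<Rightarrow> real"
  proof -
    have "continuous_on ((UNIV \<times> S) \<times> cbox 0 1)
        (\<lambda>q. a (z (fst (fst q) * snd q) (snd (fst q))) (snd (fst q)))"
      by (intro continuous_on_time_space[OF cont] continuous_on_time_space[OF z] continuous_intros) auto
    then show ?thesis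
      unfolding case_prod_unfold
      by (rule continuous_on_mult[OF continuous_on_fst[OF continuous_on_fst[OF continuous_on_id]]])
  qed
  have step_cont: "continuous_on (UNIV \<times> S) (\<lambda>(t, x). step z t x)"
    if z: "continuous_on (UNIV \<times> S) (\<lambda>(t, x). z t x)" for z
    using integral_continuous_on_param[OF integrand_cont[OF z]]
    by (simp add: step_def case_prod_unfold)
  have y_cont: "continuous_on (UNIV \<times> S) (\<lambda>(t, x). y n t x)" for n
    by (induction n) (auto simp: ySuc step_cont, simp add: y_def)
  have slice: "continuous_on UNIV (\<lambda>t. z t x)"
    if z: "continuous_on (UNIV \<times> S) (\<lambda>(t, x). z t x)" and "x \<in> S" for z :: "real \<Rightarrow> 'a \<Rightarrow> real" and x
    by (intro continuous_on_time_space[OF z] continuous_intros \<open>x \<in> S\<close>)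
  have speed_cont: "continuous_on UNIV (\<lambda>s. a (z s x) x)"
    if z: "continuous_on (UNIV \<times> S) (\<lambda>(t, x). z t x)" and "x \<in> S" for z :: "real \<Rightarrow> 'a \<Rightarrow> real" and x
    by (intro continuous_on_time_space[OF cont] slice[OF z] continuous_intros \<open>x \<in> S\<close>)
  have integrable: "(\<lambda>r. t * a (z (t * r) x) x) integrable_on {0..1}"
    if z: "continuous_on (UNIV \<times> S) (\<lambda>(t, x). z t x)" and "x \<in> S" for z :: "real \<Rightarrow> 'a \<Rightarrow> real" and x t
    by (rule integrable_continuous_real)
      (intro continuous_intros continuous_on_compose2[OF speed_cont[OF that]], auto)
  have step_bound: "\<bar>step z t x - step z' t x\<bar> \<le> L * C * \<bar>t\<bar> ^ Suc n / real (Suc n)"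
    if z: "continuous_on (UNIV \<times> S) (\<lambda>(t, x). z t x)" and z': "continuous_on (UNIV \<times> S) (\<lambda>(t, x). z' t x)"
      and x: "x \<in> S" and b: "\<And>s. \<bar>s\<bar> \<le> \<bar>t\<bar> \<Longrightarrow> \<bar>z s x - z' s x\<bar> \<le> C * \<bar>s\<bar> ^ n" for z z' t x C n
  proof -
    have pow: "((\<lambda>r. r ^ n) has_integral 1 / real (Suc n)) {0..1::real}"
    proof -
      have "((\<lambda>r. r ^ n) has_integral 1 ^ Suc n / real (Suc n) - 0 ^ Suc n / real (Suc n)) {0..1::real}"
      proof (rule fundamental_theorem_of_calculus)
        fix r :: real
        have "((\<lambda>r. r ^ Suc n / real (Suc n)) has_real_derivative r ^ n) (at r within {0..1})"
          using DERIV_cdivide[OF DERIV_pow[of "Suc n" r "{0..1}"], of "real (Suc n)"]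
          by (simp add: mult.commute del: of_nat_Suc)
        then show "((\<lambda>r. r ^ Suc n / real (Suc n)) has_vector_derivative r ^ n) (at r within {0..1})"
          by (simp add: has_real_derivative_iff_has_vector_derivative)
      qed simp
      then show ?thesis by simp
    qed
    have bnd: "((\<lambda>r. L * C * \<bar>t\<bar> ^ Suc n * r ^ n) has_integral L * C * \<bar>t\<bar> ^ Suc n * (1 / real (Suc n))) {0..1::real}"
      by (rule has_integral_mult_right[OF pow])
    have "norm (integral {0..1} (\<lambda>r. t * a (z (t * r) x) x - t * a (z' (t * r) x) x))
        \<le> integral {0..1} (\<lambda>r. L * C * \<bar>t\<bar> ^ Suc n * r ^ n)"
    proof (rule integral_norm_bound_integral)
      fix r :: real assume r: "r \<in> {0..1}"
      have "\<bar>t * r\<bar> \<le> \<bar>t\<bar>" using r by (simp add: abs_mult mult_left_le)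
      note b' = b[OF this]
      have "\<bar>t * a (z (t * r) x) x - t * a (z' (t * r) x) x\<bar> = \<bar>t\<bar> * \<bar>a (z (t * r) x) x - a (z' (t * r) x) x\<bar>"
        by (simp add: abs_mult flip: right_diff_distrib)
      also have "\<dots> \<le> \<bar>t\<bar> * (L * \<bar>z (t * r) x - z' (t * r) x\<bar>)"
        by (intro mult_left_mono lip x) auto
      also have "\<dots> \<le> \<bar>t\<bar> * (L * (C * \<bar>t * r\<bar> ^ n))"
        by (intro mult_left_mono b' L) auto
      also have "\<dots> = L * C * \<bar>t\<bar> ^ Suc n * r ^ n"
        using r by (simp add: abs_mult power_mult_distrib)
      finally show "norm (t * a (z (t * r) x) x - t * a (z' (t * r) x) x) \<le> L * C * \<bar>t\<bar> ^ Suc n * r ^ n"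
        by simp
    qed (use integrable[OF z x] integrable[OF z' x] bnd in \<open>auto intro: integrable_diff\<close>)
    then show ?thesis
      unfolding integral_diff[OF integrable[OF z x] integrable[OF z' x]] integral_unique[OF bnd]
      by (simp only: step_def real_norm_def times_divide_eq_right mult_1_right)
  qed
  have y_diff: "\<bar>y (Suc n) t x - y n t x\<bar> \<le> M * L ^ n * \<bar>t\<bar> ^ Suc n / fact (Suc n)" if x: "x \<in> S" for n t x
  proof (induction n arbitrary: t)
    case 0
    have "y (Suc 0) t x = t * a 0 x" by (simp add: y_def step_def)
    moreover have "\<bar>t\<bar> * \<bar>a 0 x\<bar> \<le> \<bar>t\<bar> * M" by (intro mult_left_mono bdd x) auto
    ultimately show ?case by (simp add: y_def abs_mult mult.commute)
  next
    case (Suc n)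
    have "\<bar>step (y (Suc n)) t x - step (y n) t x\<bar>
        \<le> L * (M * L ^ n / fact (Suc n)) * \<bar>t\<bar> ^ Suc (Suc n) / real (Suc (Suc n))"
      by (rule step_bound[OF y_cont y_cont x]) (use Suc.IH in \<open>simp add: field_simps\<close>)
    then show ?case by (simp add: ySuc field_simps)
  qed
  define \<tau> where "\<tau> t x = (\<Sum>n. y (Suc n) t x - y n t x)" for t x
  have unif: "uniform_limit ({- R..R} \<times> S) (\<lambda>n (t, x). y n t x) (\<lambda>(t, x). \<tau> t x) sequentially"
    if R: "R \<ge> 0" for R
  proof -
    have "uniform_limit ({- R..R} \<times> S) (\<lambda>n p. \<Sum>i<n. y (Suc i) (fst p) (snd p) - y i (fst p) (snd p))
        (\<lambda>p. \<Sum>i. y (Suc i) (fst p) (snd p) - y i (fst p) (snd p)) sequentially"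
    proof (rule Weierstrass_m_test)
      fix n p assume "p \<in> {- R..R} \<times> S"
      then have p: "\<bar>fst p\<bar> \<le> R" "snd p \<in> S" by auto
      have M: "0 \<le> M" using bdd[OF x0, of 0] by linarith
      have "norm (y (Suc n) (fst p) (snd p) - y n (fst p) (snd p)) \<le> M * L ^ n * \<bar>fst p\<bar> ^ Suc n / fact (Suc n)"
        using y_diff[OF p(2)] by simp
      also have "\<dots> \<le> M * L ^ n * R ^ Suc n / fact n"
        using p(1) L M R by (intro frac_le mult_left_mono power_mono fact_mono) auto
      also have "\<dots> = M * R * (inverse (fact n) * (L * R) ^ n)"
        by (simp add: field_simps power_mult_distrib)
      finally show "norm (y (Suc n) (fst p) (snd p) - y n (fst p) (snd p)) \<le> M * R * (inverse (fact n) * (L * R) ^ n)" .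
    qed (intro summable_mult summable_exp)
    moreover have "(\<Sum>i<n. y (Suc i) t x - y i t x) = y n t x" for n t x
      by (subst sum_lessThan_telescope) (simp add: y_def)
    ultimately show ?thesis by (simp add: \<tau>_def case_prod_unfold)
  qed
  have \<tau>_cont: "continuous_on (UNIV \<times> S) (\<lambda>(t, x). \<tau> t x)"
  proof (unfold continuous_on_eq_continuous_within, intro ballI)
    fix p :: "real \<times> 'a" assume p: "p \<in> UNIV \<times> S"
    define R where "R = \<bar>fst p\<bar> + 1"
    have "continuous_on ({- R..R} \<times> S) (\<lambda>(t, x). \<tau> t x)"
      by (rule uniform_limit_theorem[OF _ unif])
        (auto simp: R_def intro!: always_eventually continuous_on_subset[OF y_cont])
    moreover have "p \<in> {- R..R} \<times> S" using p by (auto simp: R_def)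
    ultimately have "continuous (at p within {- R..R} \<times> S) (\<lambda>(t, x). \<tau> t x)"
      by (auto simp: continuous_on_eq_continuous_within)
    moreover have "at p within {- R..R} \<times> S = at p within UNIV \<times> S"
      by (rule at_within_nhd[of _ "{- R<..<R} \<times> UNIV"]) (use p in \<open>auto simp: R_def open_Times mem_Times_iff\<close>)
    ultimately show "continuous (at p within UNIV \<times> S) (\<lambda>(t, x). \<tau> t x)" by simp
  qed
  have fixpoint: "\<tau> t x = step \<tau> t x" if x: "x \<in> S" for t x
  proof -
    have "- \<bar>t\<bar> \<le> t" by linarith
    then have lim: "(\<lambda>n. y n t x) \<longlonglongrightarrow> \<tau> t x"
      using tendsto_uniform_limitI[OF unif[of "\<bar>t\<bar>"], of "(t, x)"] x by auto
    have "(\<lambda>n. step (y n) t x) \<longlonglongrightarrow> step \<tau> t x"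
    proof (rule LIMSEQ_I)
      fix e :: real assume e: "e > 0"
      define d where "d = e / (L * \<bar>t\<bar> + 1)"
      have pos: "L * \<bar>t\<bar> + 1 > 0" using L by (simp add: add_nonneg_pos)
      have d: "d > 0" using e pos by (simp add: d_def)
      obtain N where N: "\<And>n p. n \<ge> N \<Longrightarrow> p \<in> {- \<bar>t\<bar>..\<bar>t\<bar>} \<times> S \<Longrightarrow>
          dist (case p of (t, x) \<Rightarrow> y n t x) (case p of (t, x) \<Rightarrow> \<tau> t x) < d"
        using unif[of "\<bar>t\<bar>"] d unfolding uniform_limit_iff eventually_sequentially by fastforce
      have "norm (step (y n) t x - step \<tau> t x) < e" if n: "n \<ge> N" for n
      proof -
        have "\<bar>y n s x - \<tau> s x\<bar> \<le> d * \<bar>s\<bar> ^ 0" if "\<bar>s\<bar> \<le> \<bar>t\<bar>" for s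
        proof -
          have "- \<bar>t\<bar> \<le> s" "s \<le> \<bar>t\<bar>" using that by linarith+
          then show ?thesis using N[OF n, of "(s, x)"] x by (auto simp: dist_real_def)
        qed
        from step_bound[OF y_cont \<tau>_cont x this]
        have "\<bar>step (y n) t x - step \<tau> t x\<bar> \<le> d * (L * \<bar>t\<bar>)" by (simp add: mult.commute mult.left_commute)
        also have "\<dots> < d * (L * \<bar>t\<bar> + 1)" using d by simp
        also have "\<dots> = e" using pos by (simp add: d_def)
        finally show ?thesis by simp
      qed
      then show "\<exists>N. \<forall>n\<ge>N. norm (step (y n) t x - step \<tau> t x) < e" by blast
    qed
    then have "(\<lambda>n. y (Suc n) t x) \<longlonglongrightarrow> step \<tau> t x" by (simp add: ySuc)
    then show ?thesis by (rule LIMSEQ_unique[OF LIMSEQ_Suc[OF lim]])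
  qed
  show ?thesis
  proof
    show "continuous_on (UNIV \<times> S) (\<lambda>(t, x). \<tau> t x)" by (rule \<tau>_cont)
    show "\<tau> 0 x = 0" if "x \<in> S" for x using fixpoint[OF that, of 0] by (simp add: step_def)
    show "((\<lambda>t. \<tau> t x) has_real_derivative a (\<tau> t x) x) (at t)" if x: "x \<in> S" for x t
    proof -
      have "(\<lambda>t. integral {0..1} (\<lambda>r. t * a (\<tau> (t * r) x) x)) = (\<lambda>t. \<tau> t x)"
        by (rule ext) (rule fixpoint[OF x, unfolded step_def, symmetric])
      then show ?thesis
        using unit_integral_antiderivative[OF speed_cont[OF \<tau>_cont x], of t] by (simp only:)
    qed
  qed
qed

section \<open>Time changes of flows\<close>

lemma at_within_openin:
  assumes "openin (top_of_set S) U" "x \<in> U"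
  shows "at x within U = at x within S"
proof -
  obtain T where "open T" "U = S \<inter> T" using assms openin_open by metis
  then show ?thesis using assms at_within_nhd[of x T U S] by auto
qed

lemma smooth_on_continuous_on:
  assumes "smooth_on A f" shows "continuous_on A f"
proof (unfold continuous_on_eq_continuous_within, intro ballI)
  fix x assume x: "x \<in> A"
  then obtain U g where U: "open U" "x \<in> U" "\<forall>k. Ck_on k U g" "\<forall>y\<in>U \<inter> A. g y = f y"
    using assms unfolding smooth_on_def by blast
  have "continuous_on U g" using U(3)[rule_format, of 0] by simp
  then have "continuous_on (U \<inter> A) f"
    using U(4) continuous_on_subset[of U g "U \<inter> A"] continuous_on_eq[of "U \<inter> A" g f] by simp
  then have "continuous (at x within U \<inter> A) f"
    using U(2) x by (auto simp: continuous_on_eq_continuous_within)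
  moreover have "at x within U \<inter> A = at x within A"
    using U x by (intro at_within_openin) (auto simp: openin_open_Int Int_commute)
  ultimately show "continuous (at x within A) f" by simp
qed

lemma smooth_fun_continuous_on:
  assumes atlas: "smooth_atlas S \<A>" and g: "smooth_fun \<A> g"
  shows "continuous_on S g"
proof (unfold continuous_on_eq_continuous_within, intro ballI)
  fix x assume x: "x \<in> S"
  then obtain U \<phi> where c: "(U, \<phi>) \<in> \<A>" "x \<in> U"
    using atlas unfolding smooth_atlas_def by fastforce
  then have chart: "surface_chart S (U, \<phi>)" using atlas unfolding smooth_atlas_def by blast
  then have U: "openin (top_of_set S) U" and hom: "homeomorphism U (\<phi> ` U) \<phi> (inv_into U \<phi>)"
    unfolding surface_chart_def by auto
  have "continuous_on (\<phi> ` U) (g \<circ> inv_into U \<phi>)"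
    using bspec[OF g[unfolded smooth_fun_def] c(1)] by (intro smooth_on_continuous_on) simp
  then have "continuous_on U (\<lambda>y. (g \<circ> inv_into U \<phi>) (\<phi> y))"
    by (rule continuous_on_compose2) (use hom in \<open>auto simp: homeomorphism_def\<close>)
  then have "continuous_on U g"
    using hom by (simp add: homeomorphism_def cong: continuous_on_cong)
  then have "continuous (at x within U) g"
    using c(2) by (auto simp: continuous_on_eq_continuous_within)
  then show "continuous (at x within S) g" using at_within_openin[OF U c(2)] by simp
qed

lemma flow_continuous: "is_flow S v \<Longrightarrow> continuous_on (UNIV \<times> S) (\<lambda>(t, x). v t x)"
  unfolding is_flow_def by (rule conjunct1)

lemma flow_in:
  assumes "is_flow S v" "x \<in> S" shows "v t x \<in> S"
  using bspec[OF conjunct2[OF assms(1)[unfolded is_flow_def]] assms(2)] by blast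

lemma flow_zero:
  assumes "is_flow S v" "x \<in> S" shows "v 0 x = x"
  using bspec[OF conjunct2[OF assms(1)[unfolded is_flow_def]] assms(2)] by blast

lemma flow_add:
  assumes "is_flow S v" "x \<in> S" shows "v (s + t) x = v s (v t x)"
  using bspec[OF conjunct2[OF assms(1)[unfolded is_flow_def]] assms(2)] by blast

lemma generates_derivative:
  assumes "generates S \<A> X v" "smooth_fun \<A> g" "x \<in> S"
  shows "((\<lambda>s. g (v s x)) has_real_derivative X (v s x) g) (at s)"
  using assms unfolding generates_def integral_curve_def by blast

text \<open>The derivative of \<open>f\<close> along an orbit is \<open>X f\<close>, and a continuous function on a compact set is bounded.
This supplies the Lipschitz condition even when the field itself is not Lipschitz.\<close>

lemma smooth_fun_lipschitz_along_flow:
  assumes S: "compact S" and vf: "vector_field S \<A> X" and gen: "generates S \<A> X v" and f: "smooth_fun \<A> f"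
  obtains L where "\<And>x. x \<in> S \<Longrightarrow> \<bar>X x f\<bar> \<le> L"
    "\<And>x s s'. x \<in> S \<Longrightarrow> \<bar>f (v s x) - f (v s' x)\<bar> \<le> L * \<bar>s - s'\<bar>"
proof -
  have "continuous_on S (\<lambda>p. X p f)" using vf f unfolding vector_field_def by blast
  then have "bounded ((\<lambda>p. X p f) ` S)" using S compact_continuous_image compact_imp_bounded by blast
  then obtain L where L: "\<And>x. x \<in> S \<Longrightarrow> \<bar>X x f\<bar> \<le> L" unfolding bounded_iff by auto
  have "\<bar>f (v s x) - f (v s' x)\<bar> \<le> L * \<bar>s - s'\<bar>" if x: "x \<in> S" for x s s'
  proof -
    have "norm (f (v s x) - f (v s' x)) \<le> L * norm (s - s')"
    proof (rule field_differentiable_bound[of UNIV])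
      fix t show "((\<lambda>s. f (v s x)) has_field_derivative X (v t x) f) (at t within UNIV)"
        using generates_derivative[OF gen f x] by simp
      have "v t x \<in> S" using gen x unfolding generates_def is_flow_def by blast
      then show "norm (X (v t x) f) \<le> L" using L by simp
    qed auto
    then show ?thesis by simp
  qed
  then show ?thesis using that L by blast
qed

text \<open>A solution that reaches a zero of the right-hand side coincides with the constant solution.\<close>

lemma stalls_at_zero:
  fixes \<tau> h :: "real \<Rightarrow> real"
  assumes "\<And>u v. \<bar>h u - h v\<bar> \<le> L * \<bar>u - v\<bar>"
    and "\<And>t. (\<tau> has_real_derivative h (\<tau> t)) (at t)" and "h (\<tau> t) = 0"
  shows "\<tau> s = \<tau> t"
  by (rule scalar_ode_unique[of UNIV t \<tau> "\<lambda>_. \<tau> t" h L]) (use assms in auto)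

text \<open>Integral curves of \<open>f X\<close> are time changes of those of \<open>X\<close>. Along such a curve \<open>u = f \<circ> \<gamma>\<close> satisfies
\<open>u' = u * X f\<close>, so \<open>u\<close> vanishes everywhere or nowhere. In the first case \<open>\<gamma>\<close> stays in the
totally disconnected zero set and is constant. In the second case the time change \<open>s' = u\<close> is
invertible, and the reparametrised curve is an integral curve of \<open>X\<close>, for which uniqueness is known.\<close>

lemma integral_curve_scaled_field:
  assumes S: "compact S" and vf: "vector_field S \<A> X" and gen: "generates S \<A> X v"
    and f: "smooth_fun \<A> f" and nonneg: "\<And>x. x \<in> S \<Longrightarrow> 0 \<le> f x"
    and td: "totally_disconnected {x \<in> S. f x = 0}"
    and I: "open I" "is_interval I" "0 \<in> I"
    and \<gamma>: "integral_curve S \<A> (scale_field f X) I \<gamma>"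
    and \<tau>0: "\<tau> 0 = 0" and \<tau>: "\<And>t. (\<tau> has_real_derivative f (v (\<tau> t) (\<gamma> 0))) (at t)"
    and t1: "t1 \<in> I"
  shows "\<gamma> t1 = v (\<tau> t1) (\<gamma> 0)"
proof -
  define x where "x = \<gamma> 0"
  have \<gamma>_cont: "continuous_on I \<gamma>" and \<gamma>S: "\<And>t. t \<in> I \<Longrightarrow> \<gamma> t \<in> S"
    and \<gamma>d: "\<And>g t. smooth_fun \<A> g \<Longrightarrow> t \<in> I \<Longrightarrow> ((\<lambda>s. g (\<gamma> s)) has_real_derivative f (\<gamma> t) * X (\<gamma> t) g) (at t)"
    using \<gamma> unfolding integral_curve_def scale_field_def by auto
  have x: "x \<in> S" using \<gamma>S I x_def by auto
  have v0: "v 0 x = x" using gen x unfolding generates_def is_flow_def by blast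
  obtain L where L: "\<And>x. x \<in> S \<Longrightarrow> \<bar>X x f\<bar> \<le> L"
    "\<And>x s s'. x \<in> S \<Longrightarrow> \<bar>f (v s x) - f (v s' x)\<bar> \<le> L * \<bar>s - s'\<bar>"
    using smooth_fun_lipschitz_along_flow[OF S vf gen f] by blast
  show ?thesis
  proof (cases "\<exists>t0\<in>I. f (\<gamma> t0) = 0")
    case True
    then obtain t0 where t0: "t0 \<in> I" "f (\<gamma> t0) = 0" by blast
    have zero: "f (\<gamma> t) = 0" if t: "t \<in> I" for t
    proof (rule linear_growth_zero[OF I(2) t0(1), of "\<lambda>t. f (\<gamma> t)" "\<lambda>t. f (\<gamma> t) * X (\<gamma> t) f" L])
      fix t assume t: "t \<in> I"
      show "\<bar>f (\<gamma> t) * X (\<gamma> t) f\<bar> \<le> L * \<bar>f (\<gamma> t)\<bar>"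
        using mult_right_mono[OF L(1)[OF \<gamma>S[OF t]], of "\<bar>f (\<gamma> t)\<bar>"] by (simp add: abs_mult mult.commute)
    qed (use \<gamma>d[OF f] t t0 in auto)
    have "connected (\<gamma> ` I)"
      using \<gamma>_cont I(2) connected_continuous_image is_interval_connected by blast
    moreover have "\<gamma> ` I \<subseteq> {x \<in> S. f x = 0}" using zero \<gamma>S by auto
    ultimately have "\<gamma> t1 = x"
      using td t1 I(3) unfolding totally_disconnected_def x_def by blast
    moreover have "\<tau> t1 = \<tau> 0"
      by (rule stalls_at_zero[of "\<lambda>s. f (v s x)" L])
        (use L(2)[OF x] \<tau> zero[OF I(3)] \<tau>0 v0 in \<open>auto simp: x_def\<close>)
    ultimately show ?thesis using \<tau>0 v0 by (simp add: x_def)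
  next
    case False
    then have pos: "f (\<gamma> t) > 0" if "t \<in> I" for t
      using nonneg[OF \<gamma>S[OF that]] that by (metis order_le_less)
    have "min 0 t1 \<in> I" "max 0 t1 \<in> I" using I(3) t1 by (simp_all add: min_def max_def)
    then obtain e0 e1 where e: "e0 > 0" "ball (min 0 t1) e0 \<subseteq> I" "e1 > 0" "ball (max 0 t1) e1 \<subseteq> I"
      using I(1) open_contains_ball by metis
    define c d where "c = min 0 t1 - e0 / 2" and "d = max 0 t1 + e1 / 2"
    have cd: "c < 0" "0 < d" "c < t1" "t1 < d" using e by (auto simp: c_def d_def)
    have "c \<in> ball (min 0 t1) e0" "d \<in> ball (max 0 t1) e1" using e by (auto simp: c_def d_def dist_real_def)
    then have cdI': "c \<in> I" "d \<in> I" using e by auto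
    have cdI: "t \<in> I" if "c \<le> t" "t \<le> d" for t
      using mem_is_interval_1_I[OF I(2) cdI'] that by blast
    \<comment> \<open>Clamping the argument extends \<open>f \<circ> \<gamma>\<close> from \<open>[c, d]\<close> to a positive continuous function on the line.\<close>
    define h where "h t = f (\<gamma> (max c (min d t)))" for t
    have clampI: "max c (min d t) \<in> I" for t using cdI cd by auto
    have hpos: "h t > 0" for t using pos clampI by (simp add: h_def)
    have "continuous_on I (\<lambda>t. f (\<gamma> t))"
      using \<gamma>d[OF f] DERIV_isCont continuous_at_imp_continuous_on by blast
    then have "continuous_on UNIV h"
      unfolding h_def by (rule continuous_on_compose2) (use clampI in \<open>auto intro!: continuous_intros\<close>)
    note h_cont = this
    define s where "s = (\<lambda>t. integral {0..1} (\<lambda>r. t * h (t * r)))"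
    have s: "s 0 = 0" "\<And>t. (s has_real_derivative h t) (at t)"
      unfolding s_def using unit_integral_antiderivative[OF h_cont] by simp_all
    have hf: "h t = f (\<gamma> t)" if "c < t" "t < d" for t using that by (simp add: h_def)
    have smono: "s a < s b" if "a < b" for a b
      using DERIV_pos_imp_increasing[OF that] s(2) hpos by blast
    have sinj: "s a = s b \<longleftrightarrow> a = b" for a b using smono[of a b] smono[of b a] by (cases a b rule: linorder_cases) auto
    define r where "r = inv s"
    have rs: "r (s t) = t" for t
      unfolding r_def by (rule inv_f_f) (use sinj in \<open>auto intro: injI\<close>)
    define J where "J = {s c<..<s d}"
    have s_cont: "isCont s t" for t using s(2) DERIV_isCont by blast
    have J: "\<exists>t. c < t \<and> t < d \<and> j = s t" if j: "j \<in> J" for j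
    proof -
      obtain t where t: "c \<le> t" "t \<le> d" "s t = j"
        using IVT[of s c j d] s_cont j cd unfolding J_def by (auto intro: less_imp_le)
      then have "t \<noteq> c" "t \<noteq> d" using j unfolding J_def by auto
      then show ?thesis using t by (intro exI[of _ t]) auto
    qed
    have r_deriv: "(r has_real_derivative inverse (h t)) (at (s t))" if t: "c < t" "t < d" for t
    proof (rule DERIV_inverse_function[of s _ _ _ "s c" "s d"])
      show "(s has_real_derivative h t) (at (r (s t)))" using s(2) rs by simp
      show "h t \<noteq> 0" using hpos[of t] by simp
      show "s c < s t" "s t < s d" using smono t by auto
      show "s (r y) = y" if "s c < y" "y < s d" for y
        using J[of y] that rs unfolding J_def by auto
      show "isCont r (s t)"
        by (rule isCont_inverse_function[of 1]) (use rs s_cont in auto)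
    qed
    define \<beta> where "\<beta> = \<gamma> \<circ> r"
    have "integral_curve S \<A> X J \<beta>"
      unfolding integral_curve_def
    proof (intro conjI allI impI)
      have "continuous_on J r"
        using r_deriv J DERIV_isCont by (intro continuous_at_imp_continuous_on) blast
      moreover have rJ: "r ` J \<subseteq> I"
      proof (intro image_subsetI)
        fix j assume "j \<in> J"
        then obtain t where "c < t" "t < d" "j = s t" using J by blast
        then show "r j \<in> I" using rs cdI[of t] by simp
      qed
      ultimately show "continuous_on J \<beta>"
        unfolding \<beta>_def by (intro continuous_on_compose continuous_on_subset[OF \<gamma>_cont])
      show "\<beta> ` J \<subseteq> S" using \<gamma>S rJ unfolding \<beta>_def by auto
      fix g j assume g: "smooth_fun \<A> g \<and> j \<in> J"
      then obtain t where t: "c < t" "t < d" "j = s t" using J by blast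
      have "((\<lambda>y. g (\<gamma> (r y))) has_real_derivative f (\<gamma> t) * X (\<gamma> t) g * inverse (h t)) (at (s t))"
        by (rule DERIV_chain2[OF _ r_deriv[OF t(1,2)]]) (use \<gamma>d[of g t] g cdI t rs in auto)
      then show "((\<lambda>s. g (\<beta> s)) has_real_derivative X (\<beta> j) g) (at j)"
        using t rs hf[OF t(1,2)] hpos[of t] by (simp add: \<beta>_def field_simps)
    qed
    moreover have "open J" "is_interval J" "0 \<in> J"
      using smono[of c 0] smono[of 0 d] cd s(1) by (auto simp: J_def is_interval_oo)
    ultimately have "\<beta> j = v j (\<beta> 0)" if "j \<in> J" for j
      using gen that unfolding generates_def by blast
    moreover have "\<beta> 0 = x" using rs[of 0] s(1) by (simp add: \<beta>_def x_def)
    ultimately have \<beta>v: "\<beta> j = v j x" if "j \<in> J" for j using that by simp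
    have \<gamma>v: "\<gamma> t = v (s t) x" if "c < t" "t < d" for t
      using \<beta>v[of "s t"] smono that rs by (simp add: \<beta>_def J_def)
    have "s t1 = \<tau> t1"
    proof (rule scalar_ode_unique[of "{c<..<d}" 0 s \<tau> "\<lambda>s. f (v s x)" L])
      fix t assume "t \<in> {c<..<d}"
      then show "(s has_real_derivative f (v (s t) x)) (at t)"
        using s(2)[of t] hf[of t] \<gamma>v[of t] by simp
    qed (use cd s(1) \<tau>0 L(2)[OF x] \<tau> in \<open>auto simp: is_interval_oo x_def\<close>)
    then show ?thesis using \<gamma>v[OF cd(3,4)] by (simp add: x_def)
  qed
qed

text \<open>The flow property of \<open>w\<close> amounts to the cocycle identity for \<open>\<tau>\<close>, which follows from uniqueness for
the scalar equation.\<close>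

lemma time_change:
  assumes S: "compact S" and atlas: "smooth_atlas S \<A>" and vf: "vector_field S \<A> X" and gen: "generates S \<A> X v"
    and f: "smooth_fun \<A> f" and nonneg: "\<And>x. x \<in> S \<Longrightarrow> 0 \<le> f x"
    and td: "totally_disconnected {x \<in> S. f x = 0}"
  obtains w \<tau> where "generates S \<A> (scale_field f X) w"
    and "\<And>t x. w t x = v (\<tau> t x) x"
    and "\<And>x. x \<in> S \<Longrightarrow> \<tau> 0 x = 0"
    and "\<And>t x. x \<in> S \<Longrightarrow> ((\<lambda>t. \<tau> t x) has_real_derivative f (v (\<tau> t x) x)) (at t)"
proof -
  have flow: "is_flow S v" using gen unfolding generates_def by (rule conjunct1)
  note v_cont = flow_continuous[OF flow] and vS = flow_in[OF flow]
    and v0 = flow_zero[OF flow] and vadd = flow_add[OF flow]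
  have f_cont: "continuous_on S f" by (rule smooth_fun_continuous_on[OF atlas f])
  obtain L where "\<And>x. x \<in> S \<Longrightarrow> \<bar>X x f\<bar> \<le> L"
    and L: "\<And>x s s'. x \<in> S \<Longrightarrow> \<bar>f (v s x) - f (v s' x)\<bar> \<le> L * \<bar>s - s'\<bar>"
    using smooth_fun_lipschitz_along_flow[OF S vf gen f] by blast
  have "bounded (f ` S)" using S f_cont compact_continuous_image compact_imp_bounded by blast
  then obtain M where M: "\<And>x. x \<in> S \<Longrightarrow> \<bar>f x\<bar> \<le> M" unfolding bounded_iff by auto
  have "continuous_on (UNIV \<times> S) (\<lambda>p. f ((\<lambda>(s, x). v s x) p))"
    by (rule continuous_on_compose2[OF f_cont v_cont]) (clarsimp simp: vS)
  then have speed_cont: "continuous_on (UNIV \<times> S) (\<lambda>(s, x). f (v s x))"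
    by (simp add: case_prod_unfold)
  have speed_bound: "\<bar>f (v s x)\<bar> \<le> M" if "x \<in> S" for x s by (rule M[OF vS[OF that]])
  obtain \<tau> where \<tau>_cont: "continuous_on (UNIV \<times> S) (\<lambda>(t, x). \<tau> t x)"
    and \<tau>0: "\<And>x. x \<in> S \<Longrightarrow> \<tau> 0 x = 0"
    and \<tau>: "\<And>x t. x \<in> S \<Longrightarrow> ((\<lambda>t. \<tau> t x) has_real_derivative f (v (\<tau> t x) x)) (at t)"
    using picard[OF speed_cont L speed_bound] by blast
  define w where "w t x = v (\<tau> t x) x" for t x
  have cocycle: "\<tau> (s + t) x = \<tau> t x + \<tau> s (w t x)" if x: "x \<in> S" for s t x
  proof -
    have wS: "w t x \<in> S" using vS x by (simp add: w_def)
    have "\<tau> (s + t) x - \<tau> t x = \<tau> s (w t x)"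
    proof (rule scalar_ode_unique[of UNIV 0 "\<lambda>r. \<tau> (r + t) x - \<tau> t x" "\<lambda>r. \<tau> r (w t x)"
          "\<lambda>u. f (v u (w t x))" L])
      fix r
      have "((\<lambda>r. \<tau> (r + t) x) has_real_derivative f (v (\<tau> (r + t) x) x) * 1) (at r)"
        by (rule DERIV_chain2[OF \<tau>[OF x]]) (auto intro!: derivative_eq_intros)
      moreover have "v (\<tau> (r + t) x) x = v (\<tau> (r + t) x - \<tau> t x) (w t x)"
        using vadd[OF x, of "\<tau> (r + t) x - \<tau> t x" "\<tau> t x"] by (simp add: w_def)
      ultimately have "((\<lambda>r. \<tau> (r + t) x) has_real_derivative f (v (\<tau> (r + t) x - \<tau> t x) (w t x))) (at r)"
        by simp
      from DERIV_diff[OF this DERIV_const[of "\<tau> t x"]]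
      show "((\<lambda>r. \<tau> (r + t) x - \<tau> t x) has_real_derivative
          f (v (\<tau> (r + t) x - \<tau> t x) (w t x))) (at r)"
        by simp
    qed (use \<tau>0 \<tau> wS L in auto)
    then show ?thesis by simp
  qed
  have "generates S \<A> (scale_field f X) w"
    unfolding generates_def
  proof (intro conjI allI impI ballI)
    show "is_flow S w"
      unfolding is_flow_def
    proof (intro conjI ballI allI)
      have "continuous_on (UNIV \<times> S) (\<lambda>p. v (\<tau> (fst p) (snd p)) (snd p))"
        by (rule continuous_on_time_space[OF v_cont])
          (use \<tau>_cont in \<open>auto simp: case_prod_unfold intro: continuous_intros\<close>)
      then show "continuous_on (UNIV \<times> S) (\<lambda>(t, x). w t x)" by (simp add: w_def case_prod_unfold)
      fix x assume x: "x \<in> S"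
      show "w t x \<in> S" for t using vS x by (simp add: w_def)
      show "w 0 x = x" using \<tau>0 v0 x by (simp add: w_def)
      show "w (s + t) x = w s (w t x)" for s t
      proof -
        have "w (s + t) x = v (\<tau> s (w t x) + \<tau> t x) x"
          unfolding w_def[of "s + t"] cocycle[OF x, of s t] by (simp only: add.commute)
        also have "\<dots> = v (\<tau> s (w t x)) (w t x)" unfolding w_def[of t x] by (rule vadd[OF x])
        finally show ?thesis by (simp only: w_def[of s])
      qed
    qed
    fix x assume x: "x \<in> S"
    show "integral_curve S \<A> (scale_field f X) UNIV (\<lambda>t. w t x)"
      unfolding integral_curve_def
    proof (intro conjI allI impI)
      show "continuous_on UNIV (\<lambda>t. w t x)"
        unfolding w_def
        by (intro continuous_on_time_space[OF v_cont] continuous_on_time_space[OF \<tau>_cont] continuous_intros x)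
      show "range (\<lambda>t. w t x) \<subseteq> S" using vS x by (auto simp: w_def)
      fix g and t :: real assume g: "smooth_fun \<A> g \<and> t \<in> UNIV"
      show "((\<lambda>s. g (w s x)) has_real_derivative scale_field f X (w t x) g) (at t)"
        unfolding w_def scale_field_def
        using DERIV_chain2[OF generates_derivative[OF gen conjunct1[OF g] x] \<tau>[OF x]]
        by (simp add: mult.commute)
    qed
  next
    fix I \<gamma> t
    assume I: "open I \<and> is_interval I \<and> 0 \<in> I \<and> integral_curve S \<A> (scale_field f X) I \<gamma>" and t: "t \<in> I"
    then have "\<gamma> 0 \<in> S" unfolding integral_curve_def by blast
    then show "\<gamma> t = w t (\<gamma> 0)"
      unfolding w_def
      using I t \<tau>0 \<tau> by (intro integral_curve_scaled_field[OF S vf gen f nonneg td, where I = I and \<tau> = "\<lambda>t. \<tau> t (\<gamma> 0)"]) auto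
  qed
  then show ?thesis using \<tau>0 \<tau> by (rule that[OF _ w_def])
qed

section \<open>Cantor sets\<close>

text \<open>The number whose digits in base \<open>1/k\<close> are the entries of \<open>c\<close>. For \<open>k = 1/3\<close> this embeds the Cantor
space into the line; for \<open>k = 1/2\<close> it maps it onto an interval.\<close>

definition digit_sum :: "real \<Rightarrow> (nat \<Rightarrow> bool) \<Rightarrow> real" where
  "digit_sum k c = (\<Sum>n. of_bool (c n) * k ^ n)"

lemma digit_sum_summable:
  assumes "0 \<le> k" "k < (1::real)" shows "summable (\<lambda>n. of_bool (c n) * k ^ n)"
  by (rule summable_comparison_test'[OF summable_geometric[of k]]) (use assms in auto)

lemma digit_sum_bounds:
  assumes k: "0 \<le> k" "k < 1" shows "0 \<le> digit_sum k c" "digit_sum k c \<le> 1 / (1 - k)"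
proof -
  show "0 \<le> digit_sum k c"
    unfolding digit_sum_def by (rule suminf_nonneg[OF digit_sum_summable[OF k]]) (use k in auto)
  have "digit_sum k c \<le> (\<Sum>n. k ^ n)"
    unfolding digit_sum_def
    by (rule suminf_le[OF _ digit_sum_summable[OF k] summable_geometric]) (use k in auto)
  then show "digit_sum k c \<le> 1 / (1 - k)" using k by (simp add: suminf_geometric)
qed

lemma digit_sum_head:
  assumes k: "0 \<le> k" "k < 1"
  shows "digit_sum k c = of_bool (c 0) + k * digit_sum k (\<lambda>n. c (Suc n))"
proof -
  have "(\<Sum>n. of_bool (c (Suc n)) * k ^ Suc n) = digit_sum k c - of_bool (c 0)"
    using suminf_split_head[OF digit_sum_summable[OF k]] by (simp add: digit_sum_def)
  moreover have "(\<Sum>n. of_bool (c (Suc n)) * k ^ Suc n) = k * digit_sum k (\<lambda>n. c (Suc n))"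
    using suminf_mult[OF digit_sum_summable[OF k], of k "\<lambda>n. c (Suc n)"]
    by (simp add: digit_sum_def mult.left_commute)
  ultimately show ?thesis by simp
qed

lemma continuous_of_bool: "continuous_on UNIV (of_bool :: bool \<Rightarrow> real)"
  by (simp add: continuous_on_open_vimage open_discrete)

lemma continuous_digit_sum:
  assumes k: "0 \<le> k" "k < 1" shows "continuous_on UNIV (digit_sum k)"
proof -
  have lim: "uniform_limit UNIV (\<lambda>N c. \<Sum>n<N. of_bool (c n) * k ^ n) (\<lambda>c. \<Sum>n. of_bool (c n) * k ^ n) sequentially"
    by (rule Weierstrass_m_test[OF _ summable_geometric[of k]]) (use k in auto)
  have "continuous_on UNIV (\<lambda>c::nat \<Rightarrow> bool. of_bool (c n) :: real)" for n
    by (rule continuous_on_compose2[OF continuous_of_bool continuous_on_product_coordinates]) simp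
  then have "\<forall>\<^sub>F N in sequentially. continuous_on UNIV (\<lambda>c::nat \<Rightarrow> bool. \<Sum>n<N. of_bool (c n) * k ^ n)"
    by (intro always_eventually allI continuous_on_sum continuous_on_mult continuous_on_const)
  then have "continuous_on UNIV (\<lambda>c. \<Sum>n. of_bool (c n) * k ^ n)"
    by (rule uniform_limit_theorem[OF _ lim trivial_limit_sequentially])
  then show ?thesis by (simp add: digit_sum_def[abs_def])
qed

text \<open>The tail of the series is at most \<open>1/2\<close>, so the leading digit can be read off from whether the sum is at
least \<open>1\<close>; the remaining digits follow by shifting.\<close>

lemma inj_digit_sum_third: "inj (digit_sum (1/3))"
proof -
  have k: "0 \<le> (1/3::real)" "(1/3::real) < 1" by auto
  have head: "c 0 \<longleftrightarrow> digit_sum (1/3) c \<ge> 1" for c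
    using digit_sum_head[OF k, of c] digit_sum_bounds[OF k, of "\<lambda>n. c (Suc n)"] by (cases "c 0") auto
  have "c n = d n" if "digit_sum (1/3) c = digit_sum (1/3) d" for c d n
    using that
  proof (induction n arbitrary: c d)
    case 0
    then show ?case using head[of c] head[of d] by simp
  next
    case (Suc n)
    have "c 0 = d 0" using head[of c] head[of d] Suc.prems by simp
    then have "digit_sum (1/3) (\<lambda>n. c (Suc n)) = digit_sum (1/3) (\<lambda>n. d (Suc n))"
      using digit_sum_head[OF k, of c] digit_sum_head[OF k, of d] Suc.prems by simp
    from Suc.IH[OF this] show ?case .
  qed
  then show ?thesis by (intro injI ext)
qed

text \<open>The \<open>n\<close>-th binary digit of \<open>y\<close> is the parity of \<open>\<lfloor>2\<^sup>n y\<rfloor>\<close>.\<close>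

lemma digit_sum_half_surj:
  assumes y: "0 \<le> y" "y < 2" shows "\<exists>c. digit_sum (1/2) c = y"
proof -
  define a where "a n = \<lfloor>2 ^ n * y\<rfloor>" for n :: nat
  define c where "c n = odd (a n)" for n
  have a0: "real_of_int (a 0) = of_bool (c 0)"
  proof -
    have "a 0 = 0 \<or> a 0 = 1" using y unfolding a_def by (simp add: floor_eq_iff) linarith
    then show ?thesis unfolding c_def by auto
  qed
  have step: "a (Suc n) = 2 * a n + of_bool (c (Suc n))" for n
  proof -
    have "a (Suc n) = \<lfloor>2 * (2 ^ n * y)\<rfloor>" by (simp add: a_def mult.assoc)
    then have "a (Suc n) = 2 * a n \<or> a (Suc n) = 2 * a n + 1"
      unfolding a_def by linarith
    then show ?thesis unfolding c_def by auto
  qed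
  have part: "(\<Sum>n<Suc N. of_bool (c n) * (1/2) ^ n) = real_of_int (a N) / 2 ^ N" for N
  proof (induction N)
    case 0 then show ?case using a0 by simp
  next
    case (Suc N)
    then show ?case using step[of N] by (simp add: field_simps)
  qed
  have near: "\<bar>real_of_int (a N) / 2 ^ N - y\<bar> \<le> (1/2) ^ N" for N
  proof -
    have "\<bar>real_of_int (a N) - 2 ^ N * y\<bar> \<le> 1" unfolding a_def by linarith
    moreover have "real_of_int (a N) / 2 ^ N - y = (real_of_int (a N) - 2 ^ N * y) / 2 ^ N"
      by (simp add: field_simps)
    ultimately show ?thesis by (simp add: power_one_over divide_right_mono)
  qed
  have "(\<lambda>N. real_of_int (a N) / 2 ^ N) \<longlonglongrightarrow> y"
  proof (rule LIM_zero_cancel, rule Lim_null_comparison)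
    show "\<forall>\<^sub>F N in sequentially. norm (real_of_int (a N) / 2 ^ N - y) \<le> (1/2) ^ N" using near by simp
    show "(\<lambda>N. (1/2::real) ^ N) \<longlonglongrightarrow> 0" by (rule LIMSEQ_realpow_zero) auto
  qed
  then have "(\<lambda>N. \<Sum>n<Suc N. of_bool (c n) * (1/2::real) ^ n) \<longlonglongrightarrow> y" by (simp only: part)
  then have "(\<lambda>N. \<Sum>n<N. of_bool (c n) * (1/2::real) ^ n) \<longlonglongrightarrow> y" by (rule LIMSEQ_imp_Suc)
  then show ?thesis unfolding digit_sum_def using sums_def sums_unique by blast
qed

text \<open>Even and odd digits give the two coordinates.\<close>

lemma cantor_space_covers_bounded_plane_set:
  fixes P :: "(real \<times> real) set"
  assumes "bounded P"
  obtains q :: "(nat \<Rightarrow> bool) \<Rightarrow> real \<times> real" where "continuous_on UNIV q" "P \<subseteq> range q"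
proof -
  obtain R where R: "R > 0" "P \<subseteq> ball 0 R" using assms bounded_subset_ballD by blast
  have k: "0 \<le> (1/2::real)" "(1/2::real) < 1" by auto
  define z where "z j c = R * (digit_sum (1/2) (\<lambda>n. c (2 * n + j)) - 1)" for j :: nat and c
  have z_cont: "continuous_on UNIV (z j)" for j
  proof -
    have "continuous_on UNIV (\<lambda>(c::nat \<Rightarrow> bool) n. c (2 * n + j))"
      by (rule continuous_on_coordinatewise_then_product) simp
    then have "continuous_on UNIV (\<lambda>c. digit_sum (1/2) (\<lambda>n. c (2 * n + j)))"
      by (rule continuous_on_compose2[OF continuous_digit_sum[OF k]]) simp
    then show ?thesis
      unfolding z_def by (intro continuous_on_mult continuous_on_diff continuous_on_const)
  qed
  show ?thesis
  proof
    show "continuous_on UNIV (\<lambda>c. (z 0 c, z 1 c))" using z_cont by (intro continuous_on_Pair)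
    show "P \<subseteq> range (\<lambda>c. (z 0 c, z 1 c))"
    proof
      fix x assume "x \<in> P"
      then have "norm x < R" using R by auto
      then have fs: "\<bar>fst x\<bar> < R" "\<bar>snd x\<bar> < R"
        using norm_fst_le[of "fst x" "snd x"] norm_snd_le[of "snd x" "fst x"] by auto
      have in_range: "0 \<le> u / R + 1" "u / R + 1 < 2" if "\<bar>u\<bar> < R" for u
        using that R(1) by (simp_all add: abs_less_iff field_simps)
      obtain c0 where c0: "digit_sum (1/2) c0 = fst x / R + 1"
        using digit_sum_half_surj[of "fst x / R + 1"] in_range[OF fs(1)] by blast
      obtain c1 where c1: "digit_sum (1/2) c1 = snd x / R + 1"
        using digit_sum_half_surj[of "snd x / R + 1"] in_range[OF fs(2)] by blast
      define c where "c n = (if even n then c0 (n div 2) else c1 (n div 2))" for n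
      have "(\<lambda>n. c (2 * n + 0)) = c0" "(\<lambda>n. c (2 * n + 1)) = c1" by (auto simp: c_def)
      then have "(z 0 c, z 1 c) = x" using c0 c1 R(1) by (simp add: z_def)
      then show "x \<in> range (\<lambda>c. (z 0 c, z 1 c))" by (intro image_eqI[of x _ c]) simp_all
    qed
  qed
qed

lemma compact_cantor_space: "compact (UNIV :: (nat \<Rightarrow> bool) set)"
proof -
  have "compact_space (euclidean :: bool topology)"
    by (simp add: compact_space_def finite_imp_compact)
  then have "compact_space (product_topology (\<lambda>i::nat. euclidean :: bool topology) UNIV)"
    by (simp add: compact_space_product_topology)
  then show ?thesis by (simp add: euclidean_product_topology compact_space_def)
qed

text \<open>On a compact set an injective continuous map has a continuous inverse, and under this inverse
each coordinate of a connected set takes a single value.\<close>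

lemma totally_disconnected_cantor_image:
  fixes \<kappa> :: "(nat \<Rightarrow> bool) \<Rightarrow> 'a::t2_space"
  assumes D: "compact D" and \<kappa>: "continuous_on D \<kappa>" "inj_on \<kappa> D"
  shows "totally_disconnected (\<kappa> ` D)"
  unfolding totally_disconnected_def
proof (intro allI impI ballI)
  fix C x y assume C: "C \<subseteq> \<kappa> ` D" "connected C" and xy: "x \<in> C" "y \<in> C"
  let ?r = "inv_into D \<kappa>"
  have "continuous_on (\<kappa> ` D) ?r" by (rule continuous_on_inv[OF \<kappa>(1) D]) (use \<kappa>(2) in simp)
  then have r_cont: "continuous_on C ?r" using C(1) continuous_on_subset by blast
  have "?r x n = ?r y n" for n
  proof -
    have "continuous_on C (\<lambda>z. ?r z n)"
      by (rule continuous_on_compose2[OF continuous_on_product_coordinates[of n] r_cont]) simp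
    then have "continuous_on C (\<lambda>z. of_bool (?r z n) :: real)"
      by (rule continuous_on_compose2[OF continuous_of_bool]) simp
    then have conn: "connected ((\<lambda>z. of_bool (?r z n) :: real) ` C)"
      using C(2) connected_continuous_image by blast
    have "(\<lambda>z. of_bool (?r z n) :: real) ` C \<subseteq> {0, 1}" by auto
    then have "finite ((\<lambda>z. of_bool (?r z n) :: real) ` C)" by (rule finite_subset) simp
    then obtain a where a: "(\<lambda>z. of_bool (?r z n) :: real) ` C = {a}"
      using conn connected_finite_iff_sing xy(1) by blast
    have "of_bool (?r z n) = a" if "z \<in> C" for z
      using imageI[OF that, of "\<lambda>z. of_bool (?r z n) :: real"] unfolding a by simp
    from this[OF xy(1)] this[OF xy(2)] have "(of_bool (?r x n) :: real) = of_bool (?r y n)" by simp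
    then show ?thesis by (simp only: of_bool_eq_iff)
  qed
  then have "?r x = ?r y" by blast
  then show "x = y" using C(1) xy by (metis f_inv_into_f subsetD)
qed

section \<open>Functions on a surface from functions on a chart\<close>

lemma atlas_chart:
  assumes "smooth_atlas S \<A>" "(U, \<phi>) \<in> \<A>"
  shows "openin (top_of_set S) U" "openin (top_of_set half_plane) (\<phi> ` U)"
    "homeomorphism U (\<phi> ` U) \<phi> (inv_into U \<phi>)"
proof -
  have "surface_chart S (U, \<phi>)" using assms unfolding smooth_atlas_def by blast
  then show "openin (top_of_set S) U" "openin (top_of_set half_plane) (\<phi> ` U)"
    "homeomorphism U (\<phi> ` U) \<phi> (inv_into U \<phi>)"
    unfolding surface_chart_def by auto
qed

lemma homeomorphism_openin_image:
  assumes "homeomorphism U (\<phi> ` U) \<phi> \<psi>" "openin (top_of_set U) W"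
  shows "openin (top_of_set (\<phi> ` U)) (\<phi> ` W)"
  using homeomorphism_imp_open_map[OF assms] .

lemma chart_disc:
  assumes atlas: "smooth_atlas S \<A>" and c: "(U, \<phi>) \<in> \<A>" and p: "p \<in> U"
    and W: "openin (top_of_set S) W" "p \<in> W"
  obtains r where "r > 0" "compact {x \<in> U. dist (\<phi> p) (\<phi> x) \<le> r}" "{x \<in> U. dist (\<phi> p) (\<phi> x) \<le> r} \<subseteq> W"
proof -
  note chart = atlas_chart[OF atlas c]
  have inj: "inj_on \<phi> U" using chart(3) by (metis homeomorphism_apply1 inj_on_inverseI)
  have US: "U \<subseteq> S" using chart(1) openin_imp_subset by blast
  have "openin (top_of_set S) (U \<inter> W)" using chart(1) W(1) by (rule openin_Int)
  then have "openin (top_of_set U) (U \<inter> W)"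
    by (rule openin_subset_trans) (use US in auto)
  then have "openin (top_of_set half_plane) (\<phi> ` (U \<inter> W))"
    using homeomorphism_openin_image[OF chart(3)] chart(2) openin_trans by blast
  then obtain T where T: "open T" "\<phi> ` (U \<inter> W) = half_plane \<inter> T" unfolding openin_open by blast
  have "\<phi> p \<in> T" using T p W(2) by blast
  then obtain r where r: "r > 0" "cball (\<phi> p) r \<subseteq> T" using T(1) open_contains_cball by blast
  let ?Z = "{x \<in> U. dist (\<phi> p) (\<phi> x) \<le> r}"
  have sub: "half_plane \<inter> cball (\<phi> p) r \<subseteq> \<phi> ` (U \<inter> W)" using r T by blast
  have "\<phi> ` U \<subseteq> half_plane" using chart(2) openin_imp_subset by blast
  then have img: "\<phi> ` ?Z = half_plane \<inter> cball (\<phi> p) r" using sub by auto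
  have "?Z \<subseteq> W"
  proof
    fix x assume x: "x \<in> ?Z"
    then have "\<phi> x \<in> \<phi> ` (U \<inter> W)" using img sub by blast
    then show "x \<in> W" using inj x by (auto dest: inj_onD)
  qed
  moreover have "compact ?Z"
  proof -
    have "closed half_plane"
      unfolding half_plane_def by (intro closed_Collect_le continuous_intros)
    then have "compact (half_plane \<inter> cball (\<phi> p) r)" by (simp add: closed_Int_compact)
    moreover have "continuous_on (half_plane \<inter> cball (\<phi> p) r) (inv_into U \<phi>)"
      by (rule continuous_on_subset[OF homeomorphism_cont2[OF chart(3)]]) (use sub in blast)
    ultimately have "compact (inv_into U \<phi> ` \<phi> ` ?Z)" using img compact_continuous_image by metis
    then show ?thesis by (simp add: image_image inv_into_f_f inj cong: image_cong_simp)
  qed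
  ultimately show ?thesis using that r(1) by blast
qed

lemma openin_chart_ball:
  assumes atlas: "smooth_atlas S \<A>" and c: "(U, \<phi>) \<in> \<A>"
  shows "openin (top_of_set S) {x \<in> U. dist a (\<phi> x) < r}"
proof -
  note chart = atlas_chart[OF atlas c]
  have "openin (top_of_set U) (U \<inter> \<phi> -` ball a r)"
    by (rule continuous_openin_preimage_gen[OF homeomorphism_cont1[OF chart(3)] open_ball])
  moreover have "U \<inter> \<phi> -` ball a r = {x \<in> U. dist a (\<phi> x) < r}" by auto
  ultimately show ?thesis using chart(1) openin_trans by metis
qed

text \<open>The extension by \<open>1\<close> is smooth because the disc on which \<open>F\<close> may differ from \<open>1\<close> is compact, hence closed:
every point lies in the chart domain or has a neighbourhood on which the function is constant.\<close>

lemma smooth_fun_from_chart: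
  assumes atlas: "smooth_atlas S \<A>" and c: "(U, \<phi>) \<in> \<A>"
    and F: "\<And>k. Ck_on k UNIV F" and far: "\<And>z. r \<le> dist a z \<Longrightarrow> F z = 1"
    and Z: "compact {x \<in> U. dist a (\<phi> x) \<le> r}"
  shows "smooth_fun \<A> (\<lambda>x. if x \<in> U then F (\<phi> x) else (1::real))" (is "smooth_fun \<A> ?f")
proof -
  let ?Z = "{x \<in> U. dist a (\<phi> x) \<le> r}"
  have "smooth_on (\<psi> ` V) (?f \<circ> inv_into V \<psi>)" if d: "(V, \<psi>) \<in> \<A>" for V \<psi>
    unfolding smooth_on_def
  proof
    note chart = atlas_chart[OF atlas c] and chart' = atlas_chart[OF atlas d]
    have inj: "inj_on \<psi> V" using chart'(3) by (metis homeomorphism_apply1 inj_on_inverseI)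
    have VS: "V \<subseteq> S" using chart'(1) openin_imp_subset by blast
    fix y assume "y \<in> \<psi> ` V"
    then obtain z where z: "z \<in> V" "y = \<psi> z" by blast
    show "\<exists>W G. open W \<and> y \<in> W \<and> (\<forall>k. Ck_on k W G) \<and> (\<forall>y'\<in>W \<inter> \<psi> ` V. G y' = (?f \<circ> inv_into V \<psi>) y')"
    proof (cases "z \<in> U")
      case True
      have "smooth_on (\<psi> ` (V \<inter> U)) (\<phi> \<circ> inv_into V \<psi>)"
        using atlas c d unfolding smooth_atlas_def by fast
      moreover have "y \<in> \<psi> ` (V \<inter> U)" using z True by blast
      ultimately obtain W0 T where W0: "open W0" "y \<in> W0" "\<forall>k. Ck_on k W0 T"
        "\<forall>y'\<in>W0 \<inter> \<psi> ` (V \<inter> U). T y' = (\<phi> \<circ> inv_into V \<psi>) y'"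
        unfolding smooth_on_def by blast
      have "openin (top_of_set V) (V \<inter> U)"
        using chart(1) chart'(1) VS by (meson inf_le1 openin_Int openin_subset_trans)
      then have "openin (top_of_set (\<psi> ` V)) (\<psi> ` (V \<inter> U))"
        by (rule homeomorphism_openin_image[OF chart'(3)])
      then obtain W1 where W1: "open W1" "\<psi> ` (V \<inter> U) = \<psi> ` V \<inter> W1" unfolding openin_open by blast
      show ?thesis
      proof (intro exI conjI allI ballI)
        show "open (W0 \<inter> W1)" using W0 W1 by auto
        show "y \<in> W0 \<inter> W1" using W0(2) W1(2) \<open>y \<in> \<psi> ` (V \<inter> U)\<close> by blast
        show "Ck_on k (W0 \<inter> W1) (\<lambda>y. F (T y))" for k
          by (rule Ck_on_compose[OF _ open_UNIV _ F Ck_on_subset[OF W0(3)[rule_format]]]) (use W0 W1 in auto)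
        fix y' assume y': "y' \<in> (W0 \<inter> W1) \<inter> \<psi> ` V"
        then obtain z' where z': "z' \<in> V" "z' \<in> U" "y' = \<psi> z'" using W1 by blast
        then have "inv_into V \<psi> y' = z'" using inj by simp
        moreover have "T y' = (\<phi> \<circ> inv_into V \<psi>) y'" using W0(4) y' z' by blast
        ultimately show "F (T y') = (?f \<circ> inv_into V \<psi>) y'" using z' by simp
      qed
    next
      case False
      have "openin (top_of_set V) (V - ?Z)"
        using Z by (metis Diff_eq compact_imp_closed open_Compl openin_open)
      then have "openin (top_of_set (\<psi> ` V)) (\<psi> ` (V - ?Z))"
        by (rule homeomorphism_openin_image[OF chart'(3)])
      then obtain W1 where W1: "open W1" "\<psi> ` (V - ?Z) = \<psi> ` V \<inter> W1" unfolding openin_open by blast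
      show ?thesis
      proof (intro exI conjI allI ballI)
        show "open W1" by (rule W1)
        show "y \<in> W1" using W1(2) z False by blast
        show "Ck_on k W1 (\<lambda>y. 1::real)" for k by (rule Ck_on_const[OF W1(1)])
        fix y' assume "y' \<in> W1 \<inter> \<psi> ` V"
        then obtain z' where z': "z' \<in> V" "z' \<notin> ?Z" "y' = \<psi> z'" using W1 by blast
        then have "inv_into V \<psi> y' = z'" using inj by simp
        then show "1 = (?f \<circ> inv_into V \<psi>) y'" using far[of "\<phi> z'"] z' by auto
      qed
    qed
  qed
  then show ?thesis unfolding smooth_fun_def by blast
qed

lemma smooth_fun_uminus:
  assumes g: "smooth_fun \<A> g" shows "smooth_fun \<A> (\<lambda>x. (- 1) * g x)"
proof -
  have "smooth_on A (\<lambda>y. (- 1) * h y)" if h: "smooth_on A h" for A and h :: "real \<times> real \<Rightarrow> real"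
    unfolding smooth_on_def
  proof
    fix x assume "x \<in> A"
    then obtain U G where U: "open U" "x \<in> U" "\<forall>k. Ck_on k U G" "\<forall>y\<in>U \<inter> A. G y = h y"
      using h unfolding smooth_on_def by blast
    have "\<forall>k. Ck_on k U (\<lambda>y. (- 1) * G y)" using U by (intro allI Ck_on_mult Ck_on_const) auto
    then show "\<exists>U G. open U \<and> x \<in> U \<and> (\<forall>k. Ck_on k U G) \<and> (\<forall>y\<in>U \<inter> A. G y = (- 1) * h y)"
      using U by (intro exI[of _ U] exI[of _ "\<lambda>y. (- 1) * G y"]) auto
  qed
  then show ?thesis using g unfolding smooth_fun_def comp_def by fast
qed

section \<open>A totally disconnected set that blocks all orbits near a point\<close>

lemma flow_local:
  assumes flow: "is_flow S v" and W: "openin (top_of_set S) W" "p \<in> W"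
  obtains e V where "e > 0" "openin (top_of_set S) V" "p \<in> V" "V \<subseteq> W"
    "\<And>t x. \<bar>t\<bar> \<le> e \<Longrightarrow> x \<in> V \<Longrightarrow> v t x \<in> W"
proof -
  have p: "p \<in> S" using W openin_imp_subset by blast
  obtain T where T: "open T" "W = S \<inter> T" using W(1) openin_open by metis
  have "openin (top_of_set (UNIV \<times> S)) ((UNIV \<times> S) \<inter> (\<lambda>(t, x). v t x) -` T)"
    by (rule continuous_openin_preimage_gen[OF flow_continuous[OF flow] T(1)])
  then obtain P where P: "open P" "(UNIV \<times> S) \<inter> (\<lambda>(t, x). v t x) -` T = (UNIV \<times> S) \<inter> P"
    unfolding openin_open by blast
  have iff: "v t x \<in> T \<longleftrightarrow> (t, x) \<in> P" if "x \<in> S" for t x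
  proof -
    have "(t, x) \<in> (UNIV \<times> S) \<inter> (\<lambda>(t, x). v t x) -` T \<longleftrightarrow> (t, x) \<in> (UNIV \<times> S) \<inter> P"
      using P(2) by simp
    then show ?thesis using that by simp
  qed
  have "(0, p) \<in> P" using iff[OF p, of 0] flow_zero[OF flow p] W(2) T(2) by simp
  then obtain A B where AB: "open A" "open B" "0 \<in> A" "p \<in> B" "A \<times> B \<subseteq> P"
    using open_prod_elim[OF P(1)] by (metis mem_Sigma_iff)
  obtain r where r: "r > 0" "cball 0 r \<subseteq> A" using AB(1,3) open_contains_cball by blast
  show ?thesis
  proof
    show "r > 0" by (rule r)
    show "openin (top_of_set S) (S \<inter> B)" using AB(2) by (rule openin_open_Int)
    show "p \<in> S \<inter> B" using p AB by blast
    show vW: "v t x \<in> W" if "\<bar>t\<bar> \<le> r" "x \<in> S \<inter> B" for t x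
    proof -
      have "t \<in> A" using r that by (auto simp: subset_iff)
      then have "(t, x) \<in> P" using AB(5) that by blast
      then show ?thesis using iff[of x t] flow_in[OF flow, of x t] that T(2) by blast
    qed
    show "S \<inter> B \<subseteq> W"
    proof
      fix x assume x: "x \<in> S \<inter> B"
      then have "v 0 x = x" using flow_zero[OF flow] by blast
      then show "x \<in> W" using vW[of 0 x] x r(1) by simp
    qed
  qed
qed

text \<open>The set \<open>K\<close> consists of points \<open>v (\<iota> a) (\<sigma> a)\<close>, where \<open>\<sigma>\<close> maps a compact set \<open>D\<close> of Cantor
sequences onto the cross-section \<open>\<Sigma>\<close> and the times \<open>\<iota> a\<close> in \<open>[-\<delta>, -\<delta>/2]\<close> are pairwise different.
Since \<open>g\<close> is strictly increasing along orbits near \<open>p\<close>, an orbit crosses \<open>\<Sigma>\<close> once in a short time,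
which makes the parametrisation of \<open>K\<close> injective and keeps \<open>K\<close> strictly before \<open>\<Sigma>\<close>. Points of \<open>V\<close> cross \<open>\<Sigma>\<close> at times between \<open>-\<delta>/4\<close> and
\<open>\<delta>/4\<close>, whence \<open>T = 5\<delta>/4\<close>.\<close>

lemma blocking_set:
  assumes S: "compact S" and atlas: "smooth_atlas S \<A>" and vf: "vector_field S \<A> X" and gen: "generates S \<A> X v"
    and g: "smooth_fun \<A> g" and p: "p \<in> S" and pos: "X p g > 0"
    and chart: "(U, \<phi>) \<in> \<A>" "p \<in> U" and \<rho>: "\<rho> > 0"
  obtains K V T where "compact K" "totally_disconnected K"
    "K \<subseteq> {x \<in> U. dist (\<phi> p) (\<phi> x) < \<rho>}" "\<And>x. x \<in> K \<Longrightarrow> X x g > 0"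
    "openin (top_of_set S) V" "p \<in> V" "T > 0"
    "\<And>x. x \<in> V \<Longrightarrow> \<exists>m. 0 < m \<and> m \<le> T \<and> v (- m) x \<in> K"
    "\<And>x s. x \<in> V \<Longrightarrow> 0 \<le> s \<Longrightarrow> s \<le> T \<Longrightarrow> v s x \<notin> K"
proof -
  have flow: "is_flow S v" using gen unfolding generates_def by (rule conjunct1)
  have g_cont: "continuous_on S g" by (rule smooth_fun_continuous_on[OF atlas g])
  define c where "c = X p g / 2"
  have c: "c > 0" using pos by (simp add: c_def)
  have Xg: "continuous_on S (\<lambda>x. X x g)" using vf g unfolding vector_field_def by blast
  define W where "W = {x \<in> U. dist (\<phi> p) (\<phi> x) < \<rho>} \<inter> (S \<inter> (\<lambda>x. X x g) -` {c<..})"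
  have W: "openin (top_of_set S) W"
    unfolding W_def
    by (intro openin_Int openin_chart_ball[OF atlas chart(1)] continuous_openin_preimage_gen[OF Xg] open_greaterThan)
  have pW: "p \<in> W" using p chart \<rho> pos by (simp add: W_def c_def)
  have WS: "W \<subseteq> S" by (auto simp: W_def)
  obtain e V1 where e: "e > 0" and V1: "openin (top_of_set S) V1" "p \<in> V1" "V1 \<subseteq> W"
    and flowW: "\<And>t x. \<bar>t\<bar> \<le> e \<Longrightarrow> x \<in> V1 \<Longrightarrow> v t x \<in> W"
    using flow_local[OF flow W pW] by metis
  \<comment> \<open>The longest time compared below is \<open>5\<delta>/4 + \<delta> = 9\<delta>/4\<close>, less than \<open>e\<close>.\<close>
  define \<delta> where "\<delta> = e / 4"
  have \<delta>: "\<delta> > 0" using e by (simp add: \<delta>_def)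
  have V1S: "V1 \<subseteq> S" using V1(3) WS by blast
  have growth: "c * (t2 - t1) \<le> g (v t2 x) - g (v t1 x)"
    if x: "x \<in> V1" and t: "- e \<le> t1" "t1 \<le> t2" "t2 \<le> e" for x t1 t2
  proof -
    have "g (v t1 x) - c * t1 \<le> g (v t2 x) - c * t2"
    proof (rule DERIV_nonneg_imp_nondecreasing[OF t(2)])
      fix s assume s: "t1 \<le> s" "s \<le> t2"
      have "v s x \<in> W" using t s by (intro flowW[OF _ x]) auto
      then have "X (v s x) g - c * 1 \<ge> 0" by (simp add: W_def)
      moreover have "((\<lambda>t. g (v t x) - c * t) has_real_derivative X (v s x) g - c * 1) (at s)"
        by (intro DERIV_diff DERIV_cmult DERIV_ident generates_derivative[OF gen g]) (use x V1S in blast)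
      ultimately show "\<exists>y. ((\<lambda>t. g (v t x) - c * t) has_real_derivative y) (at s) \<and> y \<ge> 0" by blast
    qed
    then show ?thesis by (simp add: algebra_simps)
  qed
  have same_time: "t1 = t2" if "x \<in> V1" "\<bar>t1\<bar> \<le> e" "\<bar>t2\<bar> \<le> e" "g (v t1 x) = g (v t2 x)" for x t1 t2
  proof (rule ccontr)
    assume "t1 \<noteq> t2"
    have bounds: "- e \<le> t1" "t1 \<le> e" "- e \<le> t2" "t2 \<le> e" using that by linarith+
    consider "t1 < t2" | "t2 < t1" using \<open>t1 \<noteq> t2\<close> by linarith
    then show False
    proof cases
      case 1
      then show False using growth[OF that(1), of t1 t2] bounds that(4) mult_pos_pos[OF c, of "t2 - t1"] by simp
    next
      case 2
      then show False using growth[OF that(1), of t2 t1] bounds that(4) mult_pos_pos[OF c, of "t1 - t2"] by simp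
    qed
  qed
  obtain r where r: "r > 0" "compact {x \<in> U. dist (\<phi> p) (\<phi> x) \<le> r}" "{x \<in> U. dist (\<phi> p) (\<phi> x) \<le> r} \<subseteq> V1"
    using chart_disc[OF atlas chart V1(1,2)] by blast
  let ?Z = "{x \<in> U. dist (\<phi> p) (\<phi> x) \<le> r}"
  define \<Sigma> where "\<Sigma> = {x \<in> ?Z. g x = g p}"
  have \<Sigma>V1: "\<Sigma> \<subseteq> V1" using r(3) by (auto simp: \<Sigma>_def)
  have \<Sigma>U: "\<Sigma> \<subseteq> U" by (auto simp: \<Sigma>_def)
  have hom: "homeomorphism U (\<phi> ` U) \<phi> (inv_into U \<phi>)" by (rule atlas_chart[OF atlas chart(1)])
  have inj: "inj_on \<phi> U" using hom by (metis homeomorphism_apply1 inj_on_inverseI)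
  have "compact \<Sigma>"
  proof -
    have "continuous_on ?Z g" using g_cont r(3) V1S continuous_on_subset by blast
    then have "closedin (top_of_set ?Z) {x \<in> ?Z. g x = g p}"
      by (rule continuous_closedin_preimage_constant)
    then show ?thesis using r(2) closedin_compact unfolding \<Sigma>_def by blast
  qed
  moreover have "continuous_on \<Sigma> \<phi>" using homeomorphism_cont1[OF hom] \<Sigma>U continuous_on_subset by blast
  ultimately have \<phi>\<Sigma>: "compact (\<phi> ` \<Sigma>)" by (intro compact_continuous_image)
  obtain q :: "(nat \<Rightarrow> bool) \<Rightarrow> real \<times> real" where q: "continuous_on UNIV q" "\<phi> ` \<Sigma> \<subseteq> range q"
    by (rule cantor_space_covers_bounded_plane_set[OF compact_imp_bounded[OF \<phi>\<Sigma>]])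
  define D where "D = q -` (\<phi> ` \<Sigma>)"
  have D: "compact D"
  proof -
    have "closed D"
      unfolding D_def by (rule closed_vimage[OF compact_imp_closed[OF \<phi>\<Sigma>] q(1)])
    then show ?thesis using compact_Int_closed[OF compact_cantor_space, of D] by simp
  qed
  have k: "0 \<le> (1/3::real)" "(1/3::real) < 1" by auto
  \<comment> \<open>The sums range over \<open>[0, 3/2]\<close>, so these times lie in \<open>[-\<delta>, -\<delta>/2]\<close>.\<close>
  define \<iota> where "\<iota> a = \<delta> / 3 * digit_sum (1/3) a - \<delta>" for a
  have \<iota>: "- \<delta> \<le> \<iota> a" "\<iota> a \<le> - \<delta> / 2" for a
  proof -
    show "- \<delta> \<le> \<iota> a" using digit_sum_bounds(1)[OF k, of a] \<delta> by (simp add: \<iota>_def)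
    have "\<delta> / 3 * digit_sum (1/3) a \<le> \<delta> / 3 * (3 / 2)"
      using digit_sum_bounds(2)[OF k, of a] \<delta> by (intro mult_left_mono) auto
    then show "\<iota> a \<le> - \<delta> / 2" by (simp add: \<iota>_def)
  qed
  define \<sigma> where "\<sigma> a = inv_into U \<phi> (q a)" for a
  have \<sigma>: "\<sigma> a \<in> \<Sigma>" "\<phi> (\<sigma> a) = q a" if "a \<in> D" for a
  proof -
    obtain y where y: "y \<in> \<Sigma>" "q a = \<phi> y" using \<open>a \<in> D\<close> unfolding D_def by blast
    have "\<sigma> a = y" unfolding \<sigma>_def y(2) by (rule inv_into_f_f[OF inj subsetD[OF \<Sigma>U y(1)]])
    then show "\<sigma> a \<in> \<Sigma>" "\<phi> (\<sigma> a) = q a" using y by simp_all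
  qed
  have \<sigma>S: "\<sigma> a \<in> S" if "a \<in> D" for a using \<sigma>(1)[OF that] \<Sigma>V1 V1S by blast
  define \<kappa> where "\<kappa> a = v (\<iota> a) (\<sigma> a)" for a
  have "continuous_on D \<kappa>"
    unfolding \<kappa>_def
  proof (rule continuous_on_time_space[OF flow_continuous[OF flow]])
    show "continuous_on D \<iota>"
      unfolding \<iota>_def
      by (intro continuous_on_diff continuous_on_mult continuous_on_const
          continuous_on_subset[OF continuous_digit_sum[OF k]]) auto
    show "continuous_on D \<sigma>"
      unfolding \<sigma>_def
    proof (rule continuous_on_compose2[OF homeomorphism_cont2[OF hom]])
      show "continuous_on D q" using q(1) continuous_on_subset by blast
      show "q ` D \<subseteq> \<phi> ` U" unfolding D_def using \<Sigma>U by blast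
    qed
  qed (rule \<sigma>S)
  moreover have "inj_on \<kappa> D"
  proof (rule inj_onI)
    fix a b assume ab: "a \<in> D" "b \<in> D" "\<kappa> a = \<kappa> b"
    have "v (- \<iota> b) (\<kappa> b) = \<sigma> b"
      using flow_add[OF flow \<sigma>S[OF ab(2)], of "- \<iota> b" "\<iota> b"] flow_zero[OF flow \<sigma>S[OF ab(2)]]
      by (simp add: \<kappa>_def)
    moreover have "v (- \<iota> b) (\<kappa> a) = v (\<iota> a - \<iota> b) (\<sigma> a)"
      using flow_add[OF flow \<sigma>S[OF ab(1)], of "- \<iota> b" "\<iota> a"] by (simp add: \<kappa>_def)
    ultimately have "v (\<iota> a - \<iota> b) (\<sigma> a) = \<sigma> b" using ab(3) by simp
    moreover have "g (\<sigma> a) = g p" "g (\<sigma> b) = g p" using \<sigma>(1) ab by (auto simp: \<Sigma>_def)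
    ultimately have "g (v (\<iota> a - \<iota> b) (\<sigma> a)) = g (v 0 (\<sigma> a))"
      using flow_zero[OF flow \<sigma>S[OF ab(1)]] by simp
    moreover have "\<bar>\<iota> a - \<iota> b\<bar> \<le> e" using \<iota>[of a] \<iota>[of b] \<delta> by (simp add: \<delta>_def)
    ultimately have "\<iota> a - \<iota> b = 0"
      using same_time[of "\<sigma> a" "\<iota> a - \<iota> b" 0] \<sigma>(1)[OF ab(1)] \<Sigma>V1 e by auto
    then have "digit_sum (1/3) a = digit_sum (1/3) b" using \<delta> by (simp add: \<iota>_def)
    then show "a = b" using inj_digit_sum_third by (simp add: inj_eq)
  qed
  ultimately have K: "compact (\<kappa> ` D)" "totally_disconnected (\<kappa> ` D)"
    by (simp_all add: D compact_continuous_image totally_disconnected_cantor_image)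
  have hit: "\<exists>s. - \<delta> \<le> s \<and> s \<le> - \<delta> / 2 \<and> v s y \<in> \<kappa> ` D" if y: "y \<in> \<Sigma>" for y
  proof -
    obtain a where a: "q a = \<phi> y" using subsetD[OF q(2) imageI[OF y]] by (metis rangeE)
    then have aD: "a \<in> D" using y unfolding D_def by simp
    have "\<sigma> a = y" unfolding \<sigma>_def a by (rule inv_into_f_f[OF inj subsetD[OF \<Sigma>U y]])
    then have "v (\<iota> a) y = \<kappa> a" unfolding \<kappa>_def by simp
    then show ?thesis using \<iota>[of a] aD by (intro exI[of _ "\<iota> a"]) simp
  qed
  have KW: "\<kappa> a \<in> W" if "a \<in> D" for a
  proof -
    have "\<bar>\<iota> a\<bar> \<le> e" using \<iota>[of a] \<delta> unfolding \<delta>_def by linarith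
    then show ?thesis
      unfolding \<kappa>_def by (rule flowW) (rule subsetD[OF \<Sigma>V1 \<sigma>(1)[OF that]])
  qed
  have inner: "openin (top_of_set S) {x \<in> U. dist (\<phi> p) (\<phi> x) < r}"
    by (rule openin_chart_ball[OF atlas chart(1)])
  have p_inner: "p \<in> {x \<in> U. dist (\<phi> p) (\<phi> x) < r}" using chart(2) r(1) by simp
  obtain e2 V2 where e2: "e2 > 0" and V2: "openin (top_of_set S) V2" "p \<in> V2" "V2 \<subseteq> {x \<in> U. dist (\<phi> p) (\<phi> x) < r}"
    and flowZ: "\<And>t x. \<bar>t\<bar> \<le> e2 \<Longrightarrow> x \<in> V2 \<Longrightarrow> v t x \<in> {x \<in> U. dist (\<phi> p) (\<phi> x) < r}"
    using flow_local[OF flow inner p_inner] by blast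
  \<comment> \<open>Crossing times of at most \<open>\<delta>/4\<close> stay away from the times in \<open>[-\<delta>, -\<delta>/2]\<close> at which \<open>K\<close> is met.\<close>
  define \<eta> where "\<eta> = min (\<delta> / 4) e2"
  have \<eta>: "\<eta> > 0" "\<eta> \<le> \<delta> / 4" "\<eta> \<le> e2" using \<delta> e2 by (auto simp: \<eta>_def)
  define V where "V = V2 \<inter> (S \<inter> g -` {g p - c * \<eta><..<g p + c * \<eta>})"
  have V: "openin (top_of_set S) V"
    unfolding V_def by (intro openin_Int V2 continuous_openin_preimage_gen[OF g_cont] open_greaterThanLessThan)
  have pV: "p \<in> V" using V2 p c \<eta> by (simp add: V_def)
  have VV1: "V \<subseteq> V1" 
  proof -
    have "{x \<in> U. dist (\<phi> p) (\<phi> x) < r} \<subseteq> ?Z" by auto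
    then show ?thesis using V2(3) r(3) by (auto simp only: V_def)
  qed
  have crossing: "\<exists>\<theta>. \<bar>\<theta>\<bar> \<le> \<eta> \<and> v \<theta> x \<in> \<Sigma>" if x: "x \<in> V" for x
  proof -
    have xS: "x \<in> S" and xV1: "x \<in> V1" using x VV1 by (auto simp: V_def)
    have gx: "g p - c * \<eta> < g x" "g x < g p + c * \<eta>" using x by (auto simp: V_def)
    have v0: "v 0 x = x" by (rule flow_zero[OF flow xS])
    have "\<eta> \<le> e" using \<eta> \<delta> by (simp add: \<delta>_def)
    then have "c * \<eta> \<le> g (v \<eta> x) - g x" "c * \<eta> \<le> g x - g (v (- \<eta>) x)"
      using growth[OF xV1, of 0 \<eta>] growth[OF xV1, of "- \<eta>" 0] \<eta> v0 by auto
    then have "g (v (- \<eta>) x) \<le> g p" "g p \<le> g (v \<eta> x)" using gx by linarith+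
    moreover have "\<forall>t. - \<eta> \<le> t \<and> t \<le> \<eta> \<longrightarrow> isCont (\<lambda>t. g (v t x)) t"
      using generates_derivative[OF gen g xS] DERIV_isCont by blast
    ultimately obtain \<theta> where \<theta>: "- \<eta> \<le> \<theta>" "\<theta> \<le> \<eta>" "g (v \<theta> x) = g p"
      using IVT[of "\<lambda>t. g (v t x)" "- \<eta>" "g p" \<eta>] \<eta>(1) by auto
    then have "\<bar>\<theta>\<bar> \<le> e2" using \<eta>(3) by linarith
    then have "v \<theta> x \<in> \<Sigma>" using flowZ[of \<theta> x] x \<theta>(3) by (auto simp: \<Sigma>_def V_def)
    then show ?thesis using \<theta> by (intro exI[of _ \<theta>]) linarith
  qed
  show ?thesis
  proof (rule that[OF K])
    show "\<kappa> ` D \<subseteq> {x \<in> U. dist (\<phi> p) (\<phi> x) < \<rho>}" using KW by (auto simp: W_def)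
    show "X x g > 0" if "x \<in> \<kappa> ` D" for x
    proof -
      have "x \<in> W" using KW that by blast
      then show ?thesis using c by (simp add: W_def)
    qed
    show "openin (top_of_set S) V" "p \<in> V" by fact+
    show "5 * \<delta> / 4 > 0" using \<delta> by simp
  next
    fix x assume x: "x \<in> V"
    then have xS: "x \<in> S" by (simp add: V_def)
    obtain \<theta> where \<theta>: "\<bar>\<theta>\<bar> \<le> \<eta>" "v \<theta> x \<in> \<Sigma>" using crossing[OF x] by blast
    obtain s where s: "- \<delta> \<le> s" "s \<le> - \<delta> / 2" "v s (v \<theta> x) \<in> \<kappa> ` D" using hit[OF \<theta>(2)] by blast
    have "- (- s - \<theta>) = s + \<theta>" by simp
    then have "v (- (- s - \<theta>)) x \<in> \<kappa> ` D" using s(3) by (simp only: flow_add[OF flow xS])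
    moreover have "0 < - s - \<theta>" "- s - \<theta> \<le> 5 * \<delta> / 4" using s \<theta> \<eta> \<delta> by linarith+
    ultimately show "\<exists>m. 0 < m \<and> m \<le> 5 * \<delta> / 4 \<and> v (- m) x \<in> \<kappa> ` D" by blast
  next
    fix x s assume x: "x \<in> V" and s: "0 \<le> s" "s \<le> 5 * \<delta> / 4"
    then have xS: "x \<in> S" and xV1: "x \<in> V1" using VV1 by (auto simp: V_def)
    obtain \<theta> where \<theta>: "\<bar>\<theta>\<bar> \<le> \<eta>" "v \<theta> x \<in> \<Sigma>" using crossing[OF x] by blast
    show "v s x \<notin> \<kappa> ` D"
    proof
      assume "v s x \<in> \<kappa> ` D"
      then obtain a where a: "a \<in> D" "v s x = \<kappa> a" by blast
      have "v (s - \<iota> a) x = v (- \<iota> a) (v s x)" using flow_add[OF flow xS, of "- \<iota> a" s] by simp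
      also have "\<dots> = \<sigma> a"
        using flow_add[OF flow \<sigma>S[OF a(1)], of "- \<iota> a" "\<iota> a"] flow_zero[OF flow \<sigma>S[OF a(1)]] a(2)
        by (simp add: \<kappa>_def)
      finally have "g (v (s - \<iota> a) x) = g (v \<theta> x)" using \<sigma>(1)[OF a(1)] \<theta>(2) by (simp add: \<Sigma>_def)
      moreover have "\<bar>s - \<iota> a\<bar> \<le> e" "\<bar>\<theta>\<bar> \<le> e" "\<theta> < s - \<iota> a"
        using s \<iota>[of a] \<theta>(1) \<eta> \<delta> by (simp_all add: \<delta>_def)
      ultimately show False using same_time[OF xV1, of "s - \<iota> a" \<theta>] by simp
    qed
  qed
qed

section \<open>Wandering points behind a blocking set\<close>

text \<open>Near \<open>p\<close> the speed \<open>f\<close> is at least some \<open>\<mu> > 0\<close> up to flow time \<open>T\<close>, so after time \<open>T / \<mu>\<close> the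
elapsed flow time \<open>\<tau>\<close> is at least \<open>T\<close>. A point that is back in \<open>V\<close> at such a time has, at
some flow time between the start and now, passed a zero of \<open>f\<close>, where the motion would have stopped.\<close>

lemma wandering_if_blocked:
  assumes flow: "is_flow S v" and f: "continuous_on S f" "\<And>x. x \<in> S \<Longrightarrow> 0 \<le> f x"
    and V: "openin (top_of_set S) V" "p \<in> V" and T: "T > 0"
    and behind: "\<And>x. x \<in> V \<Longrightarrow> \<exists>m. 0 < m \<and> m \<le> T \<and> f (v (- m) x) = 0"
    and ahead: "\<And>x s. x \<in> V \<Longrightarrow> 0 \<le> s \<Longrightarrow> s \<le> T \<Longrightarrow> f (v s x) \<noteq> 0"
    and w: "\<And>t x. w t x = v (\<tau> t x) x" and \<tau>0: "\<And>x. x \<in> S \<Longrightarrow> \<tau> 0 x = 0"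
    and \<tau>: "\<And>t x. x \<in> S \<Longrightarrow> ((\<lambda>t. \<tau> t x) has_real_derivative f (v (\<tau> t x) x)) (at t)"
    and stall: "\<And>x t s. x \<in> S \<Longrightarrow> f (v (\<tau> t x) x) = 0 \<Longrightarrow> \<tau> s x = \<tau> t x"
  shows "wandering S w p"
proof -
  have VS: "V \<subseteq> S" using V(1) openin_imp_subset by blast
  have p: "p \<in> S" using V(2) VS by blast
  have fv: "continuous_on (S \<times> UNIV) (\<lambda>(x, s). f (v s x))"
  proof -
    have "continuous_on (S \<times> (UNIV::real set)) (\<lambda>z. v (snd z) (fst z))"
      by (intro continuous_on_time_space[OF flow_continuous[OF flow]] continuous_intros) auto
    then have "continuous_on (S \<times> (UNIV::real set)) (\<lambda>z. f (v (snd z) (fst z)))"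
      by (rule continuous_on_compose2[OF f(1)]) (clarsimp simp: flow_in[OF flow])
    then show ?thesis by (simp add: case_prod_unfold)
  qed
  have fp_cont: "continuous_on {0..T} (\<lambda>s. f (v s p))"
  proof -
    have "continuous_on {0..T} (\<lambda>s. (\<lambda>(x, s). f (v s x)) (p, s))"
    proof (rule continuous_on_compose2[OF fv])
      show "continuous_on {0..T} (\<lambda>s. (p, s))" by (intro continuous_intros)
    qed (use p in auto)
    then show ?thesis by simp
  qed
  obtain s0 where s0: "s0 \<in> {0..T}" "\<And>s. s \<in> {0..T} \<Longrightarrow> f (v s0 p) \<le> f (v s p)"
    using continuous_attains_inf[OF compact_Icc _ fp_cont] T by auto
  define \<mu> where "\<mu> = f (v s0 p) / 2"
  have "f (v s0 p) \<ge> 0" by (rule f(2)[OF flow_in[OF flow p]])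
  moreover have "f (v s0 p) \<noteq> 0" using ahead[OF V(2)] s0(1) by simp
  ultimately have \<mu>: "\<mu> > 0" and fp: "f (v s0 p) > \<mu>" by (simp_all add: \<mu>_def)
  have "openin (top_of_set (S \<times> UNIV)) ((S \<times> UNIV) \<inter> (\<lambda>(x, s). f (v s x)) -` {\<mu><..})"
    by (rule continuous_openin_preimage_gen[OF fv open_greaterThan])
  then obtain P where P: "open P" "(S \<times> UNIV) \<inter> (\<lambda>(x, s). f (v s x)) -` {\<mu><..} = (S \<times> UNIV) \<inter> P"
    unfolding openin_open by blast
  have iff: "f (v s x) > \<mu> \<longleftrightarrow> (x, s) \<in> P" if "x \<in> S" for s x
  proof -
    have "(x, s) \<in> (S \<times> UNIV) \<inter> (\<lambda>(x, s). f (v s x)) -` {\<mu><..} \<longleftrightarrow> (x, s) \<in> (S \<times> UNIV) \<inter> P"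
      by (simp only: P(2))
    then show ?thesis using that by simp
  qed
  have "{p} \<times> {0..T} \<subseteq> P"
  proof clarify
    fix s assume "s \<in> {0..T}"
    then have "f (v s p) > \<mu>" using s0(2)[of s] fp by linarith
    then show "(p, s) \<in> P" using iff[OF p] by blast
  qed
  from Elementary_Topology.tube_lemma[OF compact_Icc P(1) this]
  obtain B where B: "p \<in> B" "open B" "B \<times> {0..T} \<subseteq> P" by (elim exE conjE)
  have fast: "f (v s x) > \<mu>" if "x \<in> V \<inter> B" "0 \<le> s" "s \<le> T" for x s
  proof -
    have "(x, s) \<in> B \<times> {0..T}" "x \<in> S" using that VS by auto
    then show ?thesis using iff[of x s] subsetD[OF B(3)] by simp
  qed
  have exit_time: "\<tau> t x \<ge> T" if x: "x \<in> V \<inter> B" and t: "t > T / \<mu>" for x t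
  proof (rule ccontr)
    assume "\<not> \<tau> t x \<ge> T"
    then have less: "\<tau> t x < T" by simp
    have xS: "x \<in> S" using x VS by blast
    have t0: "0 \<le> t" using t divide_pos_pos[OF T \<mu>] by linarith
    have mono: "\<tau> a x \<le> \<tau> b x" if "a \<le> b" for a b
      by (rule DERIV_nonneg_imp_nondecreasing[OF that]) (use \<tau>[OF xS] f(2) flow_in[OF flow xS] in blast)
    have "\<tau> 0 x - \<mu> * 0 \<le> \<tau> t x - \<mu> * t"
    proof (rule DERIV_nonneg_imp_nondecreasing[OF t0])
      fix r assume r: "0 \<le> r" "r \<le> t"
      have "0 \<le> \<tau> r x" "\<tau> r x \<le> T" using mono[OF r(1)] mono[OF r(2)] \<tau>0[OF xS] less by auto
      then have "f (v (\<tau> r x) x) - \<mu> * 1 \<ge> 0" using fast[OF x] by (simp add: less_imp_le)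
      moreover have "((\<lambda>r. \<tau> r x - \<mu> * r) has_real_derivative f (v (\<tau> r x) x) - \<mu> * 1) (at r)"
        by (intro DERIV_diff DERIV_cmult DERIV_ident \<tau>[OF xS])
      ultimately show "\<exists>y. ((\<lambda>r. \<tau> r x - \<mu> * r) has_real_derivative y) (at r) \<and> 0 \<le> y" by blast
    qed
    then have "\<mu> * t \<le> \<tau> t x" using \<tau>0[OF xS] by simp
    moreover have "T < \<mu> * t" using t \<mu> by (simp add: field_simps)
    ultimately show False using less by simp
  qed
  have "w t ` (V \<inter> B) \<inter> (V \<inter> B) = {}" if t: "t > T / \<mu>" for t
  proof (rule ccontr)
    assume "w t ` (V \<inter> B) \<inter> (V \<inter> B) \<noteq> {}"
    then obtain x where x: "x \<in> V \<inter> B" "w t x \<in> V" by blast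
    have xS: "x \<in> S" using x VS by blast
    obtain m where m: "0 < m" "m \<le> T" "f (v (- m) (w t x)) = 0" using behind[OF x(2)] by blast
    have zero: "f (v (\<tau> t x - m) x) = 0"
      using m(3) flow_add[OF flow xS, of "- m" "\<tau> t x"] by (simp add: w)
    have t0: "0 \<le> t" using t divide_pos_pos[OF T \<mu>] by linarith
    \<comment> \<open>The zero of \<open>f\<close> behind \<open>w t x\<close> lies ahead of \<open>x\<close>, so the motion has passed it.\<close>
    have "\<tau> 0 x \<le> \<tau> t x - m" using exit_time[OF x(1) t] m \<tau>0[OF xS] by simp
    then obtain r where "\<tau> r x = \<tau> t x - m"
    proof -
      have "\<forall>r. 0 \<le> r \<and> r \<le> t \<longrightarrow> isCont (\<lambda>r. \<tau> r x) r" using \<tau>[OF xS] DERIV_isCont by blast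
      then show ?thesis
        using IVT[of "\<lambda>r. \<tau> r x" 0 "\<tau> t x - m" t] \<open>\<tau> 0 x \<le> \<tau> t x - m\<close> m(1) t0 that by auto
    qed
    then have "\<tau> t x = \<tau> t x - m" using stall[OF xS, of r t] zero by simp
    then show False using m by simp
  qed
  moreover have "openin (top_of_set S) (V \<inter> B)" using V(1) B(2) by (meson openin_Int_open)
  moreover have "T / \<mu> > 0" using T \<mu> by simp
  ultimately show ?thesis
    unfolding wandering_def using V(2) B(1) by blast
qed

section \<open>Singular points and orbits of the scaled field\<close>

lemma totally_disconnected_Un_separated:
  assumes "closed A'" "closed B'" "A' \<inter> B' = {}" "A \<subseteq> A'" "B \<subseteq> B'"
    and "totally_disconnected A" "totally_disconnected B"
  shows "totally_disconnected (A \<union> B)"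
  unfolding totally_disconnected_def
proof (intro allI impI)
  fix C assume C: "C \<subseteq> A \<union> B" "connected C"
  have sub: "C \<subseteq> A' \<union> B'" using C(1) assms(4,5) by blast
  have "A' \<inter> B' \<inter> C = {}" using assms(3) by simp
  from connected_closedD[OF C(2) this sub assms(1,2)]
  have "C \<subseteq> A \<or> C \<subseteq> B" using C(1) assms(4,5) by blast
  then show "\<forall>x\<in>C. \<forall>y\<in>C. x = y"
  proof
    assume "C \<subseteq> A"
    then show ?thesis using assms(6)[unfolded totally_disconnected_def, rule_format, OF _ C(2)] by simp
  next
    assume "C \<subseteq> B"
    then show ?thesis using assms(7)[unfolded totally_disconnected_def, rule_format, OF _ C(2)] by simp
  qed
qed

lemma sing_zero_of:
  assumes gen: "generates S \<A> X v" and x: "x \<in> sing S v" and g: "smooth_fun \<A> g"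
  shows "X x g = 0"
proof -
  have "x \<in> S" and fixed: "\<And>t. v t x = x" using x by (auto simp: sing_def)
  then have "((\<lambda>s. g x) has_real_derivative X x g) (at 0)"
    using generates_derivative[OF gen g \<open>x \<in> S\<close>, of 0] by simp
  then show ?thesis by (rule DERIV_unique[OF _ DERIV_const])
qed

lemma zero_of_imp_sing:
  assumes gen: "generates S \<A> X v" and x: "x \<in> S" "zero_of \<A> X x"
  shows "x \<in> sing S v"
proof -
  have "integral_curve S \<A> X UNIV (\<lambda>_. x)"
    using x unfolding integral_curve_def zero_of_def by simp
  then have "v t x = x" for t
    using conjunct2[OF conjunct2[OF gen[unfolded generates_def]], THEN spec[of _ UNIV], THEN spec[of _ "\<lambda>_. x"]]
    by (simp only: open_UNIV is_interval_univ UNIV_I simp_thms)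
  then show ?thesis using x(1) by (simp add: sing_def)
qed

lemma sing_scaled_field:
  assumes gen: "generates S \<A> X v" and gen': "generates S \<A> (scale_field f X) w"
  shows "sing S w \<subseteq> sing S v \<union> {x \<in> S. f x = 0}"
proof
  fix x assume x: "x \<in> sing S w"
  then have xS: "x \<in> S" by (simp add: sing_def)
  have "f x * X x g = 0" if "smooth_fun \<A> g" for g
    using sing_zero_of[OF gen' x that] by (simp add: scale_field_def)
  then have "f x = 0 \<or> zero_of \<A> X x" unfolding zero_of_def by auto
  then show "x \<in> sing S v \<union> {x \<in> S. f x = 0}"
    using zero_of_imp_sing[OF gen xS] xS by blast
qed

lemma orbit_union_of_suborbits:
  assumes flow: "is_flow S v" and x: "x \<in> S"
    and w: "\<And>t y. w t y = v (\<tau> t y) y" and w0: "\<And>y. y \<in> S \<Longrightarrow> w 0 y = y"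
  shows "orbit v x = (\<Union>y\<in>orbit v x. orbit w y)"
proof
  show "orbit v x \<subseteq> (\<Union>y\<in>orbit v x. orbit w y)"
  proof
    fix y assume y: "y \<in> orbit v x"
    then have "y \<in> S" using flow_in[OF flow x] by (auto simp: orbit_def)
    then have "y \<in> orbit w y" unfolding orbit_def by (intro image_eqI[of _ _ 0]) (simp_all add: w0)
    then show "y \<in> (\<Union>y\<in>orbit v x. orbit w y)" using y by blast
  qed
  show "(\<Union>y\<in>orbit v x. orbit w y) \<subseteq> orbit v x"
  proof
    fix z assume "z \<in> (\<Union>y\<in>orbit v x. orbit w y)"
    then obtain s t where "z = v t (v s x)" unfolding orbit_def w by blast
    then have "z = v (t + s) x" using flow_add[OF flow x] by simp
    then show "z \<in> orbit v x" unfolding orbit_def by blast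
  qed
qed

section \<open>Destroying recurrence\<close>

theorem theorem4:
  fixes S :: "'a::t2_space set"
    and \<A> :: "'a chart set"
    and X :: "'a vfield"
    and v :: "real \<Rightarrow> 'a \<Rightarrow> 'a"
  assumes "compact_surface S \<A>"
    and "vector_field S \<A> X"
    and "generates S \<A> X v"
    and "\<exists>p\<in>S. \<not> zero_of \<A> X p"
  shows "\<exists>f w. smooth_fun \<A> f \<and> f ` S \<subseteq> {0..1} \<and>
     generates S \<A> (scale_field f X) w \<and>
     \<not> non_wandering_flow S w \<and>
     (\<forall>x\<in>S. \<exists>Y\<subseteq>S. orbit v x = (\<Union>y\<in>Y. orbit w y)) \<and>
     totally_disconnected {x \<in> S. f x = 0} \<and>
     (totally_disconnected (sing S v) \<longrightarrow> totally_disconnected (sing S w))"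
proof -
  have S: "compact S" and atlas: "smooth_atlas S \<A>" using assms(1) unfolding compact_surface_def by auto
  note vf = assms(2) and gen = assms(3)
  have flow: "is_flow S v" using gen unfolding generates_def by (rule conjunct1)
  obtain p where p: "p \<in> S" "\<not> zero_of \<A> X p" using assms(4) by blast
  obtain g where g: "smooth_fun \<A> g" "X p g > 0"
  proof -
    obtain h where h: "smooth_fun \<A> h" "X p h \<noteq> 0" using p(2) unfolding zero_of_def by blast
    have "X p (\<lambda>x. (- 1) * h x) = (- 1) * X p h"
      using vf p(1) h(1) unfolding vector_field_def tangent_vector_def by blast
    then show ?thesis
      using that[of h] that[of "\<lambda>x. (- 1) * h x"] h smooth_fun_uminus[OF h(1)] by force
  qed
  obtain U \<phi> where chart: "(U, \<phi>) \<in> \<A>" "p \<in> U"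
    using atlas p(1) unfolding smooth_atlas_def by fastforce
  note US = openin_imp_subset[OF atlas_chart(1)[OF atlas chart(1)]]
  have hom: "homeomorphism U (\<phi> ` U) \<phi> (inv_into U \<phi>)" by (rule atlas_chart[OF atlas chart(1)])
  have inj: "inj_on \<phi> U" using hom by (metis homeomorphism_apply1 inj_on_inverseI)
  obtain r where r: "r > 0" "compact {x \<in> U. dist (\<phi> p) (\<phi> x) \<le> r}"
    using chart_disc[OF atlas chart openin_subtopology_self p(1)] by blast
  obtain K V T where K: "compact K" "totally_disconnected K"
    "K \<subseteq> {x \<in> U. dist (\<phi> p) (\<phi> x) < r / 2}" "\<And>x. x \<in> K \<Longrightarrow> X x g > 0"
    and V: "openin (top_of_set S) V" "p \<in> V" and T: "T > 0"
    and behind: "\<And>x. x \<in> V \<Longrightarrow> \<exists>m. 0 < m \<and> m \<le> T \<and> v (- m) x \<in> K"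
    and ahead: "\<And>x s. x \<in> V \<Longrightarrow> 0 \<le> s \<Longrightarrow> s \<le> T \<Longrightarrow> v s x \<notin> K"
    using blocking_set[OF S atlas vf gen g(1) p(1) g(2) chart half_gt_zero[OF r(1)]] by blast
  have KU: "K \<subseteq> U" using K(3) by blast
  have "compact (\<phi> ` K)"
    using K(1) homeomorphism_cont1[OF hom] KU continuous_on_subset compact_continuous_image by blast
  then have "closed (\<phi> ` K)" by (rule compact_imp_closed)
  moreover have "\<phi> ` K \<subseteq> cball (\<phi> p) (r / 2)" using K(3) by auto
  ultimately obtain F :: "real \<times> real \<Rightarrow> real" where F: "\<And>k. Ck_on k UNIV F" "\<And>z. 0 \<le> F z" "\<And>z. F z \<le> 1"
    "\<And>z. F z = 0 \<longleftrightarrow> z \<in> \<phi> ` K" "\<And>z. r \<le> dist (\<phi> p) z \<Longrightarrow> F z = 1"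
    by (rule smooth_zero_set_cutoff[where r = r]) (use r(1) in auto)
  define f where "f x = (if x \<in> U then F (\<phi> x) else 1)" for x
  have f: "smooth_fun \<A> f"
    unfolding f_def by (rule smooth_fun_from_chart[OF atlas chart(1) F(1,5) r(2)])
  have f01: "0 \<le> f x" "f x \<le> 1" for x using F(2,3) by (auto simp: f_def)
  have f0: "f x = 0 \<longleftrightarrow> x \<in> K" for x
  proof (cases "x \<in> U")
    case True
    then have "f x = 0 \<longleftrightarrow> \<phi> x \<in> \<phi> ` K" using F(4) by (simp add: f_def)
    also have "\<dots> \<longleftrightarrow> x \<in> K" using inj True KU by (meson inj_on_image_mem_iff)
    finally show ?thesis .
  next
    case False
    then show ?thesis using KU by (auto simp: f_def)
  qed
  have zeros: "{x \<in> S. f x = 0} = K" using f0 KU US by blast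
  have td: "totally_disconnected {x \<in> S. f x = 0}" using K(2) zeros by simp
  obtain w \<tau> where gen': "generates S \<A> (scale_field f X) w" and w: "\<And>t x. w t x = v (\<tau> t x) x"
    and \<tau>0: "\<And>x. x \<in> S \<Longrightarrow> \<tau> 0 x = 0"
    and \<tau>: "\<And>t x. x \<in> S \<Longrightarrow> ((\<lambda>t. \<tau> t x) has_real_derivative f (v (\<tau> t x) x)) (at t)"
    using time_change[OF S atlas vf gen f f01(1) td] by blast
  have flow': "is_flow S w" using gen' unfolding generates_def by (rule conjunct1)
  obtain L where "\<And>x. x \<in> S \<Longrightarrow> \<bar>X x f\<bar> \<le> L"
    and L: "\<And>x s s'. x \<in> S \<Longrightarrow> \<bar>f (v s x) - f (v s' x)\<bar> \<le> L * \<bar>s - s'\<bar>"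
    using smooth_fun_lipschitz_along_flow[OF S vf gen f] by blast
  have "wandering S w p"
  proof (rule wandering_if_blocked[OF flow smooth_fun_continuous_on[OF atlas f] f01(1) V T _ _ w \<tau>0 \<tau>])
    fix x s t assume "x \<in> S" "f (v (\<tau> t x) x) = 0"
    then show "\<tau> s x = \<tau> t x"
      using stalls_at_zero[of "\<lambda>u. f (v u x)" L "\<lambda>t. \<tau> t x" t s] L \<tau> by blast
  qed (use behind ahead f0 in auto)
  then have "\<not> non_wandering_flow S w" using p(1) unfolding non_wandering_flow_def by blast
  moreover have "\<exists>Y\<subseteq>S. orbit v x = (\<Union>y\<in>Y. orbit w y)" if x: "x \<in> S" for x
  proof (intro exI conjI)
    show "orbit v x \<subseteq> S" using flow_in[OF flow x] by (auto simp: orbit_def)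
    show "orbit v x = (\<Union>y\<in>orbit v x. orbit w y)"
      by (rule orbit_union_of_suborbits[where w = w and \<tau> = \<tau>, OF flow x w flow_zero[OF flow']])
  qed
  moreover have "totally_disconnected (sing S w)" if sing: "totally_disconnected (sing S v)"
  proof -
    have "closed {x \<in> S. X x g \<le> 0}"
      using vf g(1) compact_imp_closed[OF S] unfolding vector_field_def
      by (intro continuous_on_closed_Collect_le continuous_on_const) auto
    then have "totally_disconnected (sing S v \<union> K)"
    proof (rule totally_disconnected_Un_separated[OF _ compact_imp_closed[OF K(1)] _ _ subset_refl sing K(2)])
      show "{x \<in> S. X x g \<le> 0} \<inter> K = {}" using K(4) by force
      show "sing S v \<subseteq> {x \<in> S. X x g \<le> 0}"
      proof
        fix x assume x: "x \<in> sing S v"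
        then show "x \<in> {x \<in> S. X x g \<le> 0}" using sing_zero_of[OF gen x g(1)] by (simp add: sing_def)
      qed
    qed
    then show ?thesis
      using sing_scaled_field[OF gen gen'] unfolding zeros totally_disconnected_def by blast
  qed
  moreover have "f ` S \<subseteq> {0..1}" using f01 by auto
  ultimately show ?thesis using f gen' td by blast
qed

end
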